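(* Let $L$ be a finite meet-distributive lattice with more than one element, and let $n$ be the number of join-irreducible elements of $L$. Then the simplicial complex $\pm\Delta=\pm\Delta(L\setminus\{\hat 0\})$ can be obtained (up to isomorphism) from (the boundary complex of) the $n$-dimensional crosspolytope by a finite sequence of stellar subdivisions; consequently $\pm\Delta$ is combinatorially the boundary complex of an $n$-dimensional simplicial polytope.
   Context: Write $[n]=\{1,\dots,n\}$. A convex closure on $[n]$ is a map $A\mapsto\langle A\rangle$ on subsets of $[n]$ with: $A\subseteq\langle A\rangle$; $A\subseteq B\Rightarrow\langle A\rangle\subseteq\langle B\rangle$; $\langle\langle A\rangle\rangle=\langle A\rangle$; and (anti-exchange) if $x\ne y$, $x,y\notin\langle A\rangle$ and $x\in\langle A\cup\{y\}\rangle$ then $y\notin\langle A\cup\{x\}\rangle$. The closed sets ($A=\langle A\rangle$) ordered by inclusion form a lattice. Every $A\subseteq[n]$ has a unique minimal subset $\operatorname{ext}(A)\subseteq A$ with $\langle\operatorname{ext}(A)\rangle=\langle A\rangle$. A finite lattice $L$ is meet-distributive if for each $y\neq\hat 0$, if $x$ is the meet of all elements covered by $y$, then $[x,y]$ is a Boolean algebra. These are exactly the lattices of closed sets of convex closures: given $L$ with $n$ join-irreducible elements (elements $x\ne\hat 0$ not of the form $y\vee z$ with $y,z<x$), identify $[n]$ with the set of join-irreducibles and put $\langle A\rangle=\{j\in[n] : j\le\bigvee_{i\in A}i\}$; then $L$ is identified with the lattice of closed sets of this convex closure, with $\hat 0=\emptyset$ and $\hat 1=[n]$. Let $\Delta=\Delta(L\setminus\{\hat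 0\})$ be the order complex (simplicial complex of all chains) of $L\setminus\{\hat 0\}$. The simplicial complex $\pm\Delta$ is defined as follows. Its vertices are equivalence classes of pairs $(A,\varepsilon)$ with $A\in L\setminus\{\hat 0\}$ and $\varepsilon:[n]\to\{\pm1\}$, where $(A,\varepsilon)$ and $(A,\varepsilon')$ are identified when $\varepsilon|_{\operatorname{ext}(A)}=\varepsilon'|_{\operatorname{ext}(A)}$. For $\sigma=\{A_1,\dots,A_k\}\in\Delta$ and $\varepsilon:[n]\to\{\pm1\}$ put $\sigma^\varepsilon=\{(A_1,\varepsilon),\dots,(A_k,\varepsilon)\}$. The faces of $\pm\Delta$ are all $\sigma^\varepsilon$ with $\sigma\in\Delta$ and $\varepsilon:[n]\to\{\pm1\}$. The boundary complex of the $n$-dimensional crosspolytope is the simplicial complex on $\{\pm1,\dots,\pm n\}$ whose faces are the subsets containing no pair $\{i,-i\}$. The stellar subdivision of a simplicial complex $\Gamma$ over a nonempty face $\sigma\in\Gamma$ is the simplicial complex whose faces, with $v_\sigma$ a new vertex, are (1) all $\tau\in\Gamma$ with $\tau\not\supseteq\sigma$, and (2) all $\tau\cup\{v_\sigma\}$ where $\tau\in\Gamma$, $\tau\not\supseteq\sigma$ and $\tau\cup\sigma\in\Gamma$. (Over a vertex $\sigma=\{v\}$ this merely renames $v$.) *)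

theory Defs
  imports "HOL-Analysis.Analysis"
begin

section \<open>Meet-distributive lattices\<close>

text \<open>
  A finite lattice is a type of sort \<open>{finite, complete_lattice}\<close>: every nonempty finite lattice
  is complete, so that \<open>bot\<close>, \<open>top\<close>, \<open>Inf\<close> and \<open>Sup\<close> exist and are determined by the order.
\<close>

definition covered_by :: "'a::order \<Rightarrow> 'a \<Rightarrow> bool" where
  "covered_by z y \<longleftrightarrow> z < y \<and> (\<nexists>w. z < w \<and> w < y)"

text \<open>The interval \<open>[x, y]\<close> is a sublattice; Boolean means distributive and complemented.\<close>

definition boolean_interval :: "'a::lattice \<Rightarrow> 'a \<Rightarrow> bool" where
  "boolean_interval x y \<longleftrightarrow> x \<le> y \<and>
     (\<forall>a\<in>{x..y}. \<forall>b\<in>{x..y}. \<forall>c\<in>{x..y}. inf a (sup b c) = sup (inf a b) (inf a c)) \<and>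
     (\<forall>a\<in>{x..y}. \<exists>b\<in>{x..y}. inf a b = x \<and> sup a b = y)"

definition meet_distributive :: "'a::{finite, complete_lattice} itself \<Rightarrow> bool" where
  "meet_distributive _ \<longleftrightarrow>
     (\<forall>y::'a. y \<noteq> bot \<longrightarrow> boolean_interval (Inf {z. covered_by z y}) y)"

definition join_irreducible :: "'a::bounded_lattice_bot \<Rightarrow> bool" where
  "join_irreducible x \<longleftrightarrow> x \<noteq> bot \<and> (\<nexists>y z. y < x \<and> z < x \<and> x = sup y z)"


section \<open>The closure on the join-irreducibles\<close>

text \<open>
  The ground set \<open>[n]\<close> is taken to be the set of join-irreducibles itself. The lattice element \<open>x\<close>
  is identified with the closed set \<open>irreducibles_below x\<close>.
\<close>

definition irreducibles_below :: "'a::bounded_lattice_bot \<Rightarrow> 'a set" where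
  "irreducibles_below x = {j. join_irreducible j \<and> j \<le> x}"

definition lattice_closure :: "'a::complete_lattice set \<Rightarrow> 'a set" where
  "lattice_closure A = irreducibles_below (Sup A)"

text \<open>
  The unique inclusion-minimal subset of \<open>A\<close> with the same closure as \<open>A\<close>. Uniqueness is a property
  of convex closures; the value is unspecified for a map \<open>cl\<close> for which it fails.
\<close>

definition extreme_points :: "('a set \<Rightarrow> 'a set) \<Rightarrow> 'a set \<Rightarrow> 'a set" where
  "extreme_points cl A =
     (THE E. E \<subseteq> A \<and> cl E = cl A \<and> (\<forall>F. F \<subset> E \<longrightarrow> cl F \<noteq> cl A))"

definition lattice_ext :: "'a::complete_lattice \<Rightarrow> 'a set" where
  "lattice_ext x = extreme_points lattice_closure (irreducibles_below x)"


section \<open>Abstract simplicial complexes\<close>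

text \<open>A complex is its set of faces, including the empty face; its vertex set is the union.\<close>

definition complex_isomorphic :: "'v set set \<Rightarrow> 'w set set \<Rightarrow> bool" where
  "complex_isomorphic \<Gamma> \<Gamma>' \<longleftrightarrow> (\<exists>f. bij_betw f (\<Union>\<Gamma>) (\<Union>\<Gamma>') \<and> (\<lambda>\<tau>. f ` \<tau>) ` \<Gamma> = \<Gamma>')"

definition order_complex :: "'a::order set \<Rightarrow> 'a set set" where
  "order_complex S = {\<sigma>. finite \<sigma> \<and> \<sigma> \<subseteq> S \<and> Complete_Partial_Order.chain (\<le>) \<sigma>}"

definition crosspolytope_boundary :: "nat \<Rightarrow> int set set" where
  "crosspolytope_boundary n =
     {\<tau>. \<tau> \<subseteq> {i. i \<noteq> 0 \<and> \<bar>i\<bar> \<le> int n} \<and> \<not> (\<exists>i. i \<in> \<tau> \<and> - i \<in> \<tau>)}"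

definition stellar_subdivision :: "'v set set \<Rightarrow> 'v set \<Rightarrow> 'v \<Rightarrow> 'v set set" where
  "stellar_subdivision \<Gamma> \<sigma> v =
     {\<tau> \<in> \<Gamma>. \<not> \<sigma> \<subseteq> \<tau>} \<union>
     {\<tau> \<union> {v} | \<tau>. \<tau> \<in> \<Gamma> \<and> \<not> \<sigma> \<subseteq> \<tau> \<and> \<tau> \<union> \<sigma> \<in> \<Gamma>}"

definition stellar_step :: "'v set set \<Rightarrow> 'v set set \<Rightarrow> bool" where
  "stellar_step \<Gamma> \<Gamma>' \<longleftrightarrow>
     (\<exists>\<sigma> v. \<sigma> \<in> \<Gamma> \<and> \<sigma> \<noteq> {} \<and> v \<notin> \<Union>\<Gamma> \<and> \<Gamma>' = stellar_subdivision \<Gamma> \<sigma> v)"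


section \<open>The complex of signed chains\<close>

definition sign_vectors :: "('a::bounded_lattice_bot \<Rightarrow> int) set" where
  "sign_vectors = {j. join_irreducible j} \<rightarrow>\<^sub>E {1, - 1}"

definition sign_rel ::
  "(('a::complete_lattice \<times> ('a \<Rightarrow> int)) \<times> ('a \<times> ('a \<Rightarrow> int))) set" where
  "sign_rel = {((x, \<epsilon>), (x', \<epsilon>')). x = x' \<and> x \<noteq> bot \<and>
     \<epsilon> \<in> sign_vectors \<and> \<epsilon>' \<in> sign_vectors \<and> (\<forall>j\<in>lattice_ext x. \<epsilon> j = \<epsilon>' j)}"

definition signed_vertex ::
  "'a::complete_lattice \<Rightarrow> ('a \<Rightarrow> int) \<Rightarrow> ('a \<times> ('a \<Rightarrow> int)) set" where
  "signed_vertex x \<epsilon> = sign_rel `` {(x, \<epsilon>)}"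

definition signed_face ::
  "'a::complete_lattice set \<Rightarrow> ('a \<Rightarrow> int) \<Rightarrow> ('a \<times> ('a \<Rightarrow> int)) set set" where
  "signed_face \<sigma> \<epsilon> = (\<lambda>x. signed_vertex x \<epsilon>) ` \<sigma>"

text \<open>
  The complex \<open>\<plusminus>\<Delta>\<close>: its vertices are classes of pairs \<open>(x, \<epsilon>)\<close> under agreement of signs on
  the extreme points of \<open>x\<close>, and its faces are the chains of \<open>L - {bot}\<close> with a common \<open>\<epsilon>\<close>.
\<close>

definition pm_complex ::
  "'a::complete_lattice itself \<Rightarrow> ('a \<times> ('a \<Rightarrow> int)) set set set" where
  "pm_complex _ =
     {signed_face \<sigma> \<epsilon> | \<sigma> \<epsilon>. \<sigma> \<in> order_complex (UNIV - {bot :: 'a}) \<and> \<epsilon> \<in> sign_vectors}"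


section \<open>Simplicial polytopes\<close>

definition simplicial_polytope :: "'e::euclidean_space set \<Rightarrow> bool" where
  "simplicial_polytope P \<longleftrightarrow>
     polytope P \<and> (\<forall>F. F face_of P \<and> F \<noteq> P \<longrightarrow> (\<exists>k. k simplex F))"

text \<open>
  Each proper face is recorded by its set of vertices. The dimension of a polytope is its \<open>aff_dim\<close>,
  so an \<open>n\<close>-dimensional polytope may live in any space of dimension at least \<open>n\<close>. For a finite
  lattice type \<open>'a\<close> with \<open>n\<close> join-irreducibles \<open>(real, 'a) vec\<close> is such a space, because
  \<open>bot\<close> is not join-irreducible and hence \<open>n < CARD('a)\<close>.
\<close>

definition boundary_complex :: "'e::euclidean_space set \<Rightarrow> 'e set set" where
  "boundary_complex P = {{v. v extreme_point_of F} | F. F face_of P \<and> F \<noteq> P}"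

end

theory Submission
  imports Defs
begin

text \<open>
  Start with the crosspolytope on the join-irreducibles and run through the elements \<open>x \<noteq> bot\<close> of the
  lattice from the top downwards, subdividing for each choice of signs the face formed by the signed
  extreme points of \<open>x\<close>. In a meet-distributive lattice the extreme points of \<open>x\<close> lie in every set of
  join-irreducibles with join \<open>x\<close>; hence at every stage the faces are pairs of a signed chain of
  processed elements and a compatible set of crosspolytope vertices below it which contains no
  processed set of extreme points. In the end only the signed chains are left.

  For the polytope, a stellar subdivision is realized by a new vertex slightly beyond the barycentre
  of the subdivided face. What is carried along are a supporting functional for each face that is
  strictly smaller on all other vertices, linear independence of the faces, and the fact that the
  cones over the faces cover the space; these determine the boundary complex of the convex hull.
\<close>

section \<open>Extreme points in a meet-distributive lattice\<close>

text \<open>Going downwards is what keeps the intermediate complexes easy to describe. The processed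
  elements form an up-set, so a set \<tau> of signed irreducibles contains a processed set of
  extreme points exactly when the class of \<open>Sup \<tau>\<close> is itself processed: one
  element is tested instead of all subsets. It also puts each new vertex at the bottom of the chains
  that it joins. The lattice hypothesis enters only through the fact that a coatom of
  \<open>y\<close> loses exactly one of the irreducibles below \<open>y\<close>. The subdivisions
  are carried out in a type with room for both kinds of vertices, whereas the theorem asks for
  integers and for points of a Euclidean space. Hence the same steps are copied along isomorphisms
  twice, each time with an invariant that supplies the new vertex. Supporting functionals are
  normalized to the value 1 on their face, so that the conditions on a new point become finitely
  many strict inequalities, all valid for a small enough displacement.\<close>

lemma coatom_above:
  fixes x y :: "'a::{finite, complete_lattice}"
  assumes "x < y"
  shows "\<exists>c. covered_by c y \<and> x \<le> c"
proof -
  let ?Z = "{z. x \<le> z \<and> z < y}"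
  have "finite ?Z" "x \<in> ?Z" using assms by auto
  then obtain c where c: "c \<in> ?Z" "x \<le> c" "\<forall>b\<in>?Z. c \<le> b \<longrightarrow> c = b"
    using finite_has_maximal2[of ?Z x] by blast
  have "covered_by c y"
    unfolding covered_by_def using c by (metis (mono_tags, lifting) less_le mem_Collect_eq order_trans)
  then show ?thesis using c by blast
qed

text \<open>A minimal element among those below \<open>y\<close> but not below \<open>x\<close>
  works: all smaller elements, hence their joins, lie below \<open>x\<close>.\<close>

lemma join_irreducible_separates:
  fixes x y :: "'a::{finite, complete_lattice}"
  assumes "\<not> y \<le> x"
  obtains j where "join_irreducible j" "j \<le> y" "\<not> j \<le> x"
proof -
  let ?Z = "{z. z \<le> y \<and> \<not> z \<le> x}"
  have "finite ?Z" "y \<in> ?Z" using assms by auto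
  then obtain j where j: "j \<in> ?Z" "\<forall>b\<in>?Z. b \<le> j \<longrightarrow> j = b"
    using finite_has_minimal2[of ?Z y] by blast
  have "u \<le> x" if "u < j" for u using j that by (auto simp: less_le dest: order_trans)
  then have "join_irreducible j"
    unfolding join_irreducible_def using j(1) by auto
  then show thesis using j that by blast
qed

lemma Sup_irreducibles_below [simp]:
  "Sup (irreducibles_below x) = (x :: 'a::{finite, complete_lattice})"
proof (rule antisym)
  show "Sup (irreducibles_below x) \<le> x" by (auto intro: Sup_least simp: irreducibles_below_def)
  show "x \<le> Sup (irreducibles_below x)"
  proof (rule ccontr)
    assume "\<not> ?thesis"
    then obtain j where "join_irreducible j" "j \<le> x" "\<not> j \<le> Sup (irreducibles_below x)"
      by (rule join_irreducible_separates)
    then show False by (auto simp: irreducibles_below_def intro: Sup_upper)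
  qed
qed

lemma lattice_closure_eq_iff:
  fixes A B :: "'a::{finite, complete_lattice} set"
  shows "lattice_closure A = lattice_closure B \<longleftrightarrow> Sup A = Sup B"
  unfolding lattice_closure_def by (metis Sup_irreducibles_below)

lemma covered_by_sup:
  fixes c x y :: "'a::lattice"
  assumes "covered_by c y" "x \<le> y" "\<not> x \<le> c"
  shows "sup c x = y"
proof -
  have "c < sup c x" using assms(3) by (metis less_le sup.cobounded1 sup.cobounded2)
  moreover have "sup c x \<le> y" using assms by (auto simp: covered_by_def)
  ultimately show ?thesis using assms(1) unfolding covered_by_def by (metis less_le)
qed

lemma covered_by_not_le:
  "covered_by c y \<Longrightarrow> covered_by d y \<Longrightarrow> c \<noteq> d \<Longrightarrow> \<not> d \<le> c"
  by (auto simp: covered_by_def less_le)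

text \<open>The interval below \<open>y\<close> cut out by three coatoms lies inside the Boolean one
  cut out by all of them. Three are enough for every application; where only two occur, one is
  repeated.\<close>

lemma meet_distributive_distrib:
  fixes y :: "'a::{finite, complete_lattice}"
  assumes "meet_distributive TYPE('a)" "covered_by c1 y" "covered_by c2 y" "covered_by c3 y"
    and "inf (inf c1 c2) c3 \<le> u" "u \<le> y"
    and "inf (inf c1 c2) c3 \<le> v" "v \<le> y"
    and "inf (inf c1 c2) c3 \<le> w" "w \<le> y"
  shows "inf u (sup v w) = sup (inf u v) (inf u w)"
proof -
  let ?m = "Inf {z. covered_by z y}"
  have m: "?m \<le> inf (inf c1 c2) c3" using assms(2-4) by (auto intro: Inf_lower)
  have "y \<noteq> bot" using assms(2) by (auto simp: covered_by_def)
  then have "boolean_interval ?m y" using assms(1) by (auto simp: meet_distributive_def)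
  moreover have "u \<in> {?m..y}" "v \<in> {?m..y}" "w \<in> {?m..y}"
    using assms(5-) order_trans[OF m] by auto
  ultimately show ?thesis unfolding boolean_interval_def by blast
qed

text \<open>An element \<open>w\<close> strictly between \<open>inf c d\<close> and \<open>d\<close>
  is not below \<open>c\<close>, so it joins with \<open>c\<close> to \<open>y\<close>; meeting with
  \<open>d\<close> and distributing gives \<open>d = w\<close>. This lets the next induction pass
  from \<open>y\<close> to a coatom.\<close>

lemma meet_distributive_lower_semimodular:
  fixes y :: "'a::{finite, complete_lattice}"
  assumes md: "meet_distributive TYPE('a)" and c: "covered_by c y" and d: "covered_by d y" and "c \<noteq> d"
  shows "covered_by (inf c d) d"
  unfolding covered_by_def
proof (intro conjI notI)
  show "inf c d < d" using covered_by_not_le[OF c d \<open>c \<noteq> d\<close>] by (simp add: less_le_not_le)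
  assume "\<exists>w>inf c d. w < d"
  then obtain w where w: "inf c d < w" "w < d" by blast
  have dy: "d \<le> y" "c \<le> y" using c d by (auto simp: covered_by_def)
  have "\<not> w \<le> c" using w by (auto simp: less_le_not_le)
  then have "sup c w = y" using c w dy by (intro covered_by_sup) auto
  then have "d = inf d (sup c w)" using dy by (simp add: inf_absorb1)
  also have "\<dots> = sup (inf d c) (inf d w)"
    using w dy by (intro meet_distributive_distrib[OF md c d d]) auto
  also have "\<dots> = w" using w by (simp add: inf_commute inf_absorb2 sup_absorb2 less_imp_le)
  finally show False using w by simp
qed

text \<open>This takes the place of anti-exchange. If \<open>j\<close> or \<open>k\<close> equals
  \<open>y\<close>, then \<open>c\<close> is the only coatom and only \<open>y\<close> escapes it.
  Otherwise choose coatoms \<open>d\<close> above \<open>j\<close> and \<open>d'\<close> above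
  \<open>k\<close>: by distributivity \<open>inf d d'\<close> is not below \<open>c\<close>, so some
  irreducible \<open>i\<close> lies below both and not below \<open>c\<close>. Induction in
  \<open>d\<close> gives \<open>j = i\<close>, in \<open>d'\<close> it gives
  \<open>k = i\<close>.\<close>

lemma meet_distributive_irreducible_unique:
  fixes y :: "'a::{finite, complete_lattice}"
  assumes md: "meet_distributive TYPE('a)" and "covered_by c y"
    and "join_irreducible j" "j \<le> y" "\<not> j \<le> c"
    and "join_irreducible k" "k \<le> y" "\<not> k \<le> c"
  shows "j = k"
  using assms(2-)
proof (induction "card {..<y}" arbitrary: c y j k rule: less_induct)
  case less
  have IH: "j' = k'" if "z < y" "covered_by b z" "join_irreducible j'" "j' \<le> z" "\<not> j' \<le> b"
    "join_irreducible k'" "k' \<le> z" "\<not> k' \<le> b" for b z j' k'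
  proof (rule less.hyps[of z b])
    show "card {..<z} < card {..<y}"
      using \<open>z < y\<close> by (intro psubset_card_mono) auto
  qed (use that in auto)
  have top_irr: "u = y" if y: "join_irreducible y" and "u \<le> y" "\<not> u \<le> c" for u
  proof (rule ccontr)
    assume "u \<noteq> y"
    with that obtain d where d: "covered_by d y" "u \<le> d" using coatom_above[of u y] by (auto simp: less_le)
    then have "c \<noteq> d" using that by auto
    then have "sup c d = y"
      using covered_by_sup covered_by_not_le d(1) less.prems(1) by (metis covered_by_def less_imp_le)
    then show False using y d less.prems(1) by (auto simp: join_irreducible_def covered_by_def)
  qed
  show ?case
  proof (cases "j = y \<or> k = y")
    case True
    then show ?thesis using top_irr less.prems by metis
  next
    case False
    then obtain d d' where d: "covered_by d y" "j \<le> d" and d': "covered_by d' y" "k \<le> d'"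
      using coatom_above[of j y] coatom_above[of k y] less.prems by (metis less_le)
    have ne: "c \<noteq> d" "c \<noteq> d'" using d d' less.prems by auto
    have lt: "d < y" "d' < y" "c < y" using d d' less.prems by (auto simp: covered_by_def)
    note cov = meet_distributive_lower_semimodular[OF md less.prems(1)]
    have "\<not> inf d d' \<le> c"
    proof
      assume le: "inf d d' \<le> c"
      have sd: "sup c d' = y"
        using covered_by_sup covered_by_not_le d'(1) less.prems(1) ne lt by (metis less_imp_le)
      have "d = inf d (sup c d')" using sd lt by (simp add: inf_absorb1)
      also have "\<dots> = sup (inf d c) (inf d d')"
        using lt by (intro meet_distributive_distrib[OF md d(1) d'(1) less.prems(1)])
          (simp_all add: le_infI1 le_infI2)
      also have "\<dots> \<le> c" using le by simp
      finally show False using covered_by_not_le[OF less.prems(1) d(1)] ne by auto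
    qed
    then obtain i where i: "join_irreducible i" "i \<le> inf d d'" "\<not> i \<le> c"
      by (rule join_irreducible_separates)
    have "j = i" using i d less.prems ne by (intro IH[OF lt(1) cov[OF d(1)]]) auto
    moreover have "k = i" using i d' less.prems ne by (intro IH[OF lt(2) cov[OF d'(1)]]) auto
    ultimately show ?thesis by simp
  qed
qed

text \<open>A set with join \<open>y\<close> needs, for each coatom, an element not below it; by
  uniqueness this is the one irreducible that the coatom loses. So the irreducibles lost by coatoms
  lie in every generating set, and they generate because no coatom bounds them all.\<close>

lemma lattice_ext_least_generating:
  fixes y :: "'a::{finite, complete_lattice}"
  assumes md: "meet_distributive TYPE('a)"
  shows "Sup (lattice_ext y) = y" and "lattice_ext y \<subseteq> irreducibles_below y"
    and "\<And>T. T \<subseteq> {j. join_irreducible j} \<Longrightarrow> Sup T = y \<Longrightarrow> lattice_ext y \<subseteq> T"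
proof -
  define E where "E = {j. join_irreducible j \<and> j \<le> y \<and> (\<exists>c. covered_by c y \<and> \<not> j \<le> c)}"
  have SE: "Sup E = y"
  proof (rule ccontr)
    assume "Sup E \<noteq> y"
    moreover have "Sup E \<le> y" by (auto intro: Sup_least simp: E_def)
    ultimately obtain c where c: "covered_by c y" "Sup E \<le> c"
      using coatom_above[of "Sup E" y] by (auto simp: less_le)
    have "\<not> y \<le> c" using c by (auto simp: covered_by_def)
    then obtain j where j: "join_irreducible j" "j \<le> y" "\<not> j \<le> c"
      by (rule join_irreducible_separates)
    then have "j \<in> E" using c by (auto simp: E_def)
    then show False using j c Sup_upper[of j E] by auto
  qed
  have EI: "E \<subseteq> irreducibles_below y" by (auto simp: E_def irreducibles_below_def)
  have least: "E \<subseteq> T" if T: "T \<subseteq> {j. join_irreducible j}" "Sup T = y" for T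
  proof
    fix j assume "j \<in> E"
    then obtain c where c: "join_irreducible j" "j \<le> y" "covered_by c y" "\<not> j \<le> c"
      by (auto simp: E_def)
    have "\<not> Sup T \<le> c" using c T by (auto simp: covered_by_def)
    then obtain k where k: "k \<in> T" "\<not> k \<le> c" using Sup_least by blast
    have "j = k" using k T c Sup_upper[of k T]
      by (intro meet_distributive_irreducible_unique[OF md c(3)]) auto
    then show "j \<in> T" using k by simp
  qed
  have irr: "irreducibles_below y \<subseteq> {j. join_irreducible j}" by (auto simp: irreducibles_below_def)
  \<comment> \<open>A least generating set is the only minimal one, which settles the definite
    description.\<close>
  have "lattice_ext y = E"
    unfolding lattice_ext_def extreme_points_def
  proof (rule the_equality)
    show "E \<subseteq> irreducibles_below y \<and> lattice_closure E = lattice_closure (irreducibles_below y) \<and>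
      (\<forall>F. F \<subset> E \<longrightarrow> lattice_closure F \<noteq> lattice_closure (irreducibles_below y))"
    proof (intro conjI allI impI)
      fix F assume "F \<subset> E"
      then have "Sup F \<noteq> y" using least[of F] EI irr by blast
      then show "lattice_closure F \<noteq> lattice_closure (irreducibles_below y)"
        by (simp add: lattice_closure_eq_iff)
    qed (use EI SE in \<open>simp_all add: lattice_closure_eq_iff\<close>)
    fix T assume T: "T \<subseteq> irreducibles_below y \<and>
      lattice_closure T = lattice_closure (irreducibles_below y) \<and>
      (\<forall>F. F \<subset> T \<longrightarrow> lattice_closure F \<noteq> lattice_closure (irreducibles_below y))"
    then have "E \<subseteq> T" using irr least[of T] by (auto simp: lattice_closure_eq_iff)
    then show "T = E" using T SE by (auto simp: lattice_closure_eq_iff)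
  qed
  then show "Sup (lattice_ext y) = y" "lattice_ext y \<subseteq> irreducibles_below y"
    "\<And>T. T \<subseteq> {j. join_irreducible j} \<Longrightarrow> Sup T = y \<Longrightarrow> lattice_ext y \<subseteq> T"
    using SE EI least by auto
qed

section \<open>Isomorphism and stellar subdivision\<close>

lemma complex_isomorphicI:
  assumes "inj_on f (\<Union>\<Gamma>)" "(\<lambda>\<tau>. f ` \<tau>) ` \<Gamma> = \<Gamma>'"
  shows "complex_isomorphic \<Gamma> \<Gamma>'"
  unfolding complex_isomorphic_def bij_betw_def
  using assms by (intro exI[of _ f]) auto

lemma complex_isomorphic_sym:
  assumes "complex_isomorphic \<Gamma> \<Gamma>'"
  shows "complex_isomorphic \<Gamma>' \<Gamma>"
proof -
  obtain f where f: "inj_on f (\<Union>\<Gamma>)" "(\<lambda>\<tau>. f ` \<tau>) ` \<Gamma> = \<Gamma>'" "f ` \<Union>\<Gamma> = \<Union>\<Gamma>'"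
    using assms by (auto simp: complex_isomorphic_def bij_betw_def)
  let ?g = "inv_into (\<Union>\<Gamma>) f"
  have "?g ` f ` \<tau> = \<tau>" if "\<tau> \<in> \<Gamma>" for \<tau>
    using f(1) that by (intro inv_into_image_cancel) auto
  then have "(\<lambda>\<tau>. ?g ` \<tau>) ` \<Gamma>' = \<Gamma>"
    unfolding f(2)[symmetric] by (simp add: image_image cong: image_cong)
  moreover have "inj_on ?g (\<Union>\<Gamma>')"
    unfolding f(3)[symmetric] by (intro inj_on_inv_into) auto
  ultimately show ?thesis by (intro complex_isomorphicI)
qed

lemma complex_isomorphic_trans:
  assumes "complex_isomorphic \<Gamma> \<Gamma>'" "complex_isomorphic \<Gamma>' \<Gamma>''"
  shows "complex_isomorphic \<Gamma> \<Gamma>''"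
proof -
  obtain f where f: "bij_betw f (\<Union>\<Gamma>) (\<Union>\<Gamma>')" "(\<lambda>\<tau>. f ` \<tau>) ` \<Gamma> = \<Gamma>'"
    using assms(1) by (auto simp: complex_isomorphic_def)
  obtain g where g: "bij_betw g (\<Union>\<Gamma>') (\<Union>\<Gamma>'')" "(\<lambda>\<tau>. g ` \<tau>) ` \<Gamma>' = \<Gamma>''"
    using assms(2) by (auto simp: complex_isomorphic_def)
  have "bij_betw (g \<circ> f) (\<Union>\<Gamma>) (\<Union>\<Gamma>'')" using f(1) g(1) by (rule bij_betw_trans)
  moreover have "(\<lambda>\<tau>. (g \<circ> f) ` \<tau>) ` \<Gamma> = \<Gamma>''"
    using f(2) g(2) by (simp add: image_image image_comp[symmetric] flip: f(2))
  ultimately show ?thesis unfolding complex_isomorphic_def by blast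
qed

text \<open>The new vertices on the two sides are unrelated and may live in different types;
  freshness of both makes \<open>f(v := v')\<close> injective and equal to \<open>f\<close> on old
  faces.\<close>

lemma stellar_subdivision_isomorphic:
  assumes f: "inj_on f (\<Union>\<Gamma>)" "(\<lambda>\<tau>. f ` \<tau>) ` \<Gamma> = \<Gamma>'"
    and \<sigma>: "\<sigma> \<in> \<Gamma>" and v: "v \<notin> \<Union>\<Gamma>" and v': "v' \<notin> \<Union>\<Gamma>'"
  shows "complex_isomorphic (stellar_subdivision \<Gamma> \<sigma> v) (stellar_subdivision \<Gamma>' (f ` \<sigma>) v')"
proof -
  define g where "g = f(v := v')"
  have g: "g ` \<tau> = f ` \<tau>" if "\<tau> \<in> \<Gamma>" for \<tau>
    unfolding g_def using v that by (intro image_cong) auto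
  have gv: "g ` insert v \<tau> = insert v' (f ` \<tau>)" if "\<tau> \<in> \<Gamma>" for \<tau>
    unfolding image_insert g[OF that] by (simp add: g_def)
  have sub: "f ` \<sigma> \<subseteq> f ` \<tau> \<longleftrightarrow> \<sigma> \<subseteq> \<tau>" if "\<tau> \<in> \<Gamma>" for \<tau>
    using f(1) \<sigma> that by (intro inj_on_image_subset_iff) auto
  have face: "f ` \<rho> \<in> \<Gamma>' \<longleftrightarrow> \<rho> \<in> \<Gamma>" if "\<rho> \<subseteq> \<Union>\<Gamma>" for \<rho>
  proof
    assume "f ` \<rho> \<in> \<Gamma>'"
    then obtain \<rho>' where \<rho>': "\<rho>' \<in> \<Gamma>" "f ` \<rho> = f ` \<rho>'" using f(2) by auto
    then have "\<rho> = \<rho>'" using inj_on_image_eq_iff[OF f(1) that] by blast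
    then show "\<rho> \<in> \<Gamma>" using \<rho>' by simp
  qed (use f in auto)
  have un: "f ` \<tau> \<union> f ` \<sigma> \<in> \<Gamma>' \<longleftrightarrow> \<tau> \<union> \<sigma> \<in> \<Gamma>" if "\<tau> \<in> \<Gamma>" for \<tau>
    using face[of "\<tau> \<union> \<sigma>"] that \<sigma> by (auto simp: image_Un)
  have "\<Union>(stellar_subdivision \<Gamma> \<sigma> v) \<subseteq> insert v (\<Union>\<Gamma>)"
    by (auto simp: stellar_subdivision_def)
  moreover have "inj_on g (insert v (\<Union>\<Gamma>))"
  proof -
    have "f ` \<Union>\<Gamma> = \<Union>\<Gamma>'" using f(2) by auto
    then have "v' \<notin> f ` \<Union>\<Gamma>" using v' by simp
    then show ?thesis using f(1) v unfolding inj_on_def g_def by (simp add: image_iff) metis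
  qed
  ultimately have inj: "inj_on g (\<Union>(stellar_subdivision \<Gamma> \<sigma> v))" by (rule inj_on_subset[rotated])
  have 1: "(\<lambda>\<tau>. g ` \<tau>) ` {\<tau> \<in> \<Gamma>. \<not> \<sigma> \<subseteq> \<tau>} = {\<tau> \<in> \<Gamma>'. \<not> f ` \<sigma> \<subseteq> \<tau>}"
  proof -
    have "(\<lambda>\<tau>. g ` \<tau>) ` {\<tau> \<in> \<Gamma>. \<not> \<sigma> \<subseteq> \<tau>} = (\<lambda>\<tau>. f ` \<tau>) ` {\<tau> \<in> \<Gamma>. \<not> f ` \<sigma> \<subseteq> f ` \<tau>}"
      by (rule image_cong) (use g sub in auto)
    also have "\<dots> = {\<tau> \<in> \<Gamma>'. \<not> f ` \<sigma> \<subseteq> \<tau>}" unfolding f(2)[symmetric] by auto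
    finally show ?thesis .
  qed
  have 2: "(\<lambda>\<tau>. g ` \<tau>) ` {\<tau> \<union> {v} | \<tau>. \<tau> \<in> \<Gamma> \<and> \<not> \<sigma> \<subseteq> \<tau> \<and> \<tau> \<union> \<sigma> \<in> \<Gamma>}
    = {\<tau> \<union> {v'} | \<tau>. \<tau> \<in> \<Gamma>' \<and> \<not> f ` \<sigma> \<subseteq> \<tau> \<and> \<tau> \<union> f ` \<sigma> \<in> \<Gamma>'}" (is "_ ` ?A = ?B")
  proof -
    have "(\<lambda>\<tau>. g ` \<tau>) ` ?A
      = (\<lambda>\<tau>. g ` insert v \<tau>) ` {\<tau> \<in> \<Gamma>. \<not> \<sigma> \<subseteq> \<tau> \<and> \<tau> \<union> \<sigma> \<in> \<Gamma>}"
      by (simp add: setcompr_eq_image image_image del: image_insert)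
    also have "\<dots> = (\<lambda>\<tau>. insert v' (f ` \<tau>)) `
        {\<tau> \<in> \<Gamma>. \<not> f ` \<sigma> \<subseteq> f ` \<tau> \<and> f ` \<tau> \<union> f ` \<sigma> \<in> \<Gamma>'}"
      by (rule image_cong) (use gv sub un in \<open>auto simp del: image_insert\<close>)
    also have "\<dots> = (\<lambda>\<tau>. insert v' \<tau>) ` {\<tau> \<in> \<Gamma>'. \<not> f ` \<sigma> \<subseteq> \<tau> \<and> \<tau> \<union> f ` \<sigma> \<in> \<Gamma>'}"
      unfolding f(2)[symmetric] by blast
    also have "\<dots> = ?B" by (simp add: setcompr_eq_image)
    finally show ?thesis .
  qed
  have "(\<lambda>\<tau>. g ` \<tau>) ` stellar_subdivision \<Gamma> \<sigma> v = stellar_subdivision \<Gamma>' (f ` \<sigma>) v'"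
    unfolding stellar_subdivision_def image_Un 1 2 ..
  with inj show ?thesis by (rule complex_isomorphicI)
qed

text \<open>An isomorphic complex can imitate a step as soon as it has a fresh vertex. The invariant
  \<open>Q\<close> provides one: finiteness suffices for integers, while points must also be placed
  so that a \<open>polytopal_fan\<close> results.\<close>

lemma stellar_steps_transport:
  assumes "stellar_step\<^sup>*\<^sup>* \<Gamma> \<Gamma>'" "complex_isomorphic \<Gamma> G" "Q G"
    and step: "\<And>G \<sigma>. Q G \<Longrightarrow> \<sigma> \<in> G \<Longrightarrow> \<sigma> \<noteq> {} \<Longrightarrow>
      \<exists>v. v \<notin> \<Union>G \<and> Q (stellar_subdivision G \<sigma> v)"
  shows "\<exists>G'. Q G' \<and> stellar_step\<^sup>*\<^sup>* G G' \<and> complex_isomorphic \<Gamma>' G'"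
  using assms(1)
proof (induction rule: rtranclp_induct)
  case base
  then show ?case using assms by blast
next
  case (step \<Gamma>1 \<Gamma>2)
  then obtain G1 where G1: "Q G1" "stellar_step\<^sup>*\<^sup>* G G1" "complex_isomorphic \<Gamma>1 G1" by blast
  obtain \<sigma> v where \<sigma>: "\<sigma> \<in> \<Gamma>1" "\<sigma> \<noteq> {}" "v \<notin> \<Union>\<Gamma>1" "\<Gamma>2 = stellar_subdivision \<Gamma>1 \<sigma> v"
    using step.hyps by (auto simp: stellar_step_def)
  obtain f where f: "inj_on f (\<Union>\<Gamma>1)" "(\<lambda>\<tau>. f ` \<tau>) ` \<Gamma>1 = G1"
    using G1 by (auto simp: complex_isomorphic_def bij_betw_def)
  have \<sigma>': "f ` \<sigma> \<in> G1" "f ` \<sigma> \<noteq> {}" using f \<sigma> by auto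
  obtain v' where v': "v' \<notin> \<Union>G1" "Q (stellar_subdivision G1 (f ` \<sigma>) v')"
    using assms(4)[OF G1(1) \<sigma>'] by blast
  have "stellar_step G1 (stellar_subdivision G1 (f ` \<sigma>) v')"
    unfolding stellar_step_def using \<sigma>' v' by blast
  moreover have "complex_isomorphic \<Gamma>2 (stellar_subdivision G1 (f ` \<sigma>) v')"
    unfolding \<sigma>(4) using f \<sigma> v' by (intro stellar_subdivision_isomorphic) auto
  ultimately show ?case using v' G1(2) by (meson rtranclp.rtrancl_into_rtrancl)
qed

section \<open>Simplicial fans spanned by the boundary of a polytope\<close>

text \<open>A complete simplicial fan with its vertices in convex position around the origin.
  \<open>W\<close> may be a proper subspace because the ambient space has a coordinate for each
  lattice element. The positive value 1 on faces puts the origin strictly inside every supporting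
  halfspace. \<open>W \<noteq> {0}\<close> excludes \<open>{{}}\<close>, whose hull is empty and
  misses the origin.\<close>

definition polytopal_fan :: "'e::euclidean_space set \<Rightarrow> 'e set set \<Rightarrow> bool" where
  "polytopal_fan W \<Gamma> \<longleftrightarrow> subspace W \<and> W \<noteq> {0} \<and> finite (\<Union>\<Gamma>) \<and> \<Union>\<Gamma> \<subseteq> W \<and>
     (\<forall>F\<in>\<Gamma>. \<forall>F'. F' \<subseteq> F \<longrightarrow> F' \<in> \<Gamma>) \<and>
     (\<forall>F\<in>\<Gamma>. independent F \<and>
        (\<exists>a. (\<forall>v\<in>F. a \<bullet> v = 1) \<and> (\<forall>v\<in>\<Union>\<Gamma> - F. a \<bullet> v < 1))) \<and>
     (\<forall>x\<in>W. \<exists>F\<in>\<Gamma>. \<exists>c. (\<forall>v\<in>F. 0 \<le> c v) \<and> x = (\<Sum>v\<in>F. c v *\<^sub>R v))"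

lemma independent_imp_affine_independent:
  "independent S \<Longrightarrow> \<not> affine_dependent S"
  using affine_dependent_imp_dependent by blast

text \<open>Values on an independent set extend to a linear form, which \<open>adjoint f 1\<close>
  represents as an inner product.\<close>

lemma independent_functional:
  fixes B :: "'e::euclidean_space set"
  assumes "independent B"
  shows "\<exists>g. \<forall>x\<in>B. g \<bullet> x = h x"
proof -
  obtain f :: "'e \<Rightarrow> real" where f: "linear f" "\<forall>x\<in>B. f x = h x"
    using linear_independent_extend[OF assms, of h] by blast
  have "adjoint f 1 \<bullet> x = f x" for x
    using adjoint_works[OF f(1), of x 1] by (simp add: inner_commute)
  then show ?thesis using f by (intro exI[of _ "adjoint f 1"]) auto
qed

section \<open>Convex geometry of a polytopal fan\<close>

context
  fixes W :: "'e::euclidean_space set" and \<Gamma>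
  assumes fan: "polytopal_fan W \<Gamma>"
begin

lemma
  shows subspace: "subspace W" and nontrivial: "W \<noteq> {0}" and finite_vertices: "finite (\<Union>\<Gamma>)" and vertices: "\<Union>\<Gamma> \<subseteq> W"
    and down_closed: "\<And>F F'. F \<in> \<Gamma> \<Longrightarrow> F' \<subseteq> F \<Longrightarrow> F' \<in> \<Gamma>"
    and independent_face: "\<And>F. F \<in> \<Gamma> \<Longrightarrow> independent F"
    and support: "\<And>F. F \<in> \<Gamma> \<Longrightarrow> \<exists>a. (\<forall>v\<in>F. a \<bullet> v = 1) \<and> (\<forall>v\<in>\<Union>\<Gamma> - F. a \<bullet> v < 1)"
    and covering: "\<And>x. x \<in> W \<Longrightarrow> \<exists>F\<in>\<Gamma>. \<exists>c. (\<forall>v\<in>F. 0 \<le> c v) \<and> x = (\<Sum>v\<in>F. c v *\<^sub>R v)"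
  using fan by (simp_all add: polytopal_fan_def)

lemma finite_face: "F \<in> \<Gamma> \<Longrightarrow> finite F"
  using finite_vertices by (rule finite_subset[rotated]) auto

lemma covering_positive:
  assumes "x \<in> W"
  shows "\<exists>F\<in>\<Gamma>. \<exists>c. (\<forall>v\<in>F. 0 < c v) \<and> x = (\<Sum>v\<in>F. c v *\<^sub>R v)"
proof -
  obtain F c where F: "F \<in> \<Gamma>" "\<forall>v\<in>F. 0 \<le> c v" "x = (\<Sum>v\<in>F. c v *\<^sub>R v)"
    using covering[OF assms] by blast
  let ?F = "{v\<in>F. c v \<noteq> 0}"
  have "(\<Sum>v\<in>F. c v *\<^sub>R v) = (\<Sum>v\<in>?F. c v *\<^sub>R v)"
    using finite_face[OF F(1)] by (intro sum.mono_neutral_right) auto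
  moreover have "?F \<in> \<Gamma>" using down_closed[OF F(1)] by auto
  ultimately show ?thesis using F by (intro bexI[of _ ?F] exI[of _ c]) (auto simp: less_le)
qed

text \<open>Writing \<open>- y\<close> in the cone over a face gives a nonnegative relation among
  the vertices; division by its total weight \<open>1 + s\<close> turns it into a convex combination
  equal to 0.\<close>

lemma zero_in_hull: "0 \<in> convex hull \<Union>\<Gamma>"
proof -
  obtain w where "w \<in> W" "w \<noteq> 0" using nontrivial subspace subspace_0 by blast
  then obtain F c where "F \<in> \<Gamma>" "(\<Sum>v\<in>F. c v *\<^sub>R v) \<noteq> (0::'e)" using covering[of w] by auto
  then obtain y where y: "y \<in> \<Union>\<Gamma>" by (cases "F = {}") auto
  then have "- y \<in> W" using vertices subspace by (auto intro: subspace_neg)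
  then obtain F c where F: "F \<in> \<Gamma>" "\<forall>v\<in>F. 0 \<le> c v" "- y = (\<Sum>v\<in>F. c v *\<^sub>R v)"
    using covering by blast
  define s where "s = sum c F"
  have s: "0 \<le> s" using F by (simp add: s_def sum_nonneg)
  show ?thesis
  proof (cases "s = 0")
    case True
    then have "\<forall>v\<in>F. c v = 0" using F finite_face by (simp add: s_def sum_nonneg_eq_0_iff)
    then have "y = 0" using F(3) by simp
    then show ?thesis using y by (auto intro: hull_inc)
  next
    case False
    have "(\<Sum>v\<in>F. (c v / s) *\<^sub>R v) \<in> convex hull \<Union>\<Gamma>"
      using F s False finite_face[OF F(1)]
      by (intro convex_sum[OF _ convex_convex_hull])
        (auto simp: s_def sum_divide_distrib[symmetric] intro!: hull_inc)
    moreover have "(\<Sum>v\<in>F. (c v / s) *\<^sub>R v) = (- 1 / s) *\<^sub>R y"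
    proof -
      have "(\<Sum>v\<in>F. (c v / s) *\<^sub>R v) = (1 / s) *\<^sub>R (\<Sum>v\<in>F. c v *\<^sub>R v)"
        by (simp add: scaleR_sum_right)
      then show ?thesis unfolding F(3)[symmetric] by simp
    qed
    ultimately have z: "(- 1 / s) *\<^sub>R y \<in> convex hull \<Union>\<Gamma>" by simp
    have "(1 / (1 + s)) *\<^sub>R y + (s / (1 + s)) *\<^sub>R ((- 1 / s) *\<^sub>R y) \<in> convex hull \<Union>\<Gamma>"
      using s False y z
      by (intro convexD[OF convex_convex_hull]) (auto simp: field_simps intro: hull_inc)
    then show ?thesis using False by simp
  qed
qed

lemma subconvex_in_hull:
  assumes "finite F" "F \<subseteq> convex hull \<Union>\<Gamma>" "\<And>v. v \<in> F \<Longrightarrow> 0 \<le> c v" "sum c F \<le> 1"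
  shows "(\<Sum>v\<in>F. c v *\<^sub>R v) \<in> convex hull \<Union>\<Gamma>"
proof -
  \<comment> \<open>The index \<open>None\<close> gives the missing weight to the origin. It is kept
    apart from the points of \<open>F\<close>, among which the origin may occur.\<close>
  have "(\<Sum>v\<in>insert None (Some ` F). (case v of None \<Rightarrow> 1 - sum c F | Some v \<Rightarrow> c v) *\<^sub>R
      (case v of None \<Rightarrow> 0 | Some v \<Rightarrow> v)) \<in> convex hull \<Union>\<Gamma>"
    using assms zero_in_hull
    by (intro convex_sum[OF _ convex_convex_hull]) (auto simp: sum.reindex)
  then show ?thesis using assms(1) by (simp add: sum.reindex)
qed

text \<open>The supporting functional is 1 on the affine hull of \<open>F\<close> and below 1 on the
  hull of the other vertices, so the two are disjoint.\<close>

lemma hull_face_of: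
  assumes "F \<in> \<Gamma>"
  shows "convex hull F face_of convex hull \<Union>\<Gamma>"
proof (rule face_of_convex_hulls[OF finite_vertices])
  obtain a where a: "\<forall>v\<in>F. a \<bullet> v = 1" "\<forall>v\<in>\<Union>\<Gamma> - F. a \<bullet> v < 1"
    using support[OF assms] by blast
  have "affine hull F \<subseteq> {x. a \<bullet> x = 1}" using a by (intro hull_minimal affine_hyperplane) auto
  moreover have "convex hull (\<Union>\<Gamma> - F) \<subseteq> {x. a \<bullet> x < 1}"
    using a by (intro hull_minimal convex_halfspace_lt) auto
  ultimately show "affine hull F \<inter> convex hull (\<Union>\<Gamma> - F) = {}" by force
qed (use assms in auto)

lemma hull_ne:
  assumes "F \<in> \<Gamma>"
  shows "convex hull F \<noteq> convex hull \<Union>\<Gamma>"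
proof -
  obtain a where a: "\<forall>v\<in>F. a \<bullet> v = 1" using support[OF assms] by blast
  then have "convex hull F \<subseteq> {x. a \<bullet> x = 1}" by (intro hull_minimal convex_hyperplane) auto
  then show ?thesis using zero_in_hull by auto
qed

lemma extreme_points_hull:
  assumes "F \<in> \<Gamma>"
  shows "{v. v extreme_point_of (convex hull F)} = F"
  using extreme_point_of_convex_hull_affine_independent[OF
      independent_imp_affine_independent[OF independent_face[OF assms]]] by auto

text \<open>A relative interior point \<open>x\<close> of \<open>G\<close> lies in the cone over
  some \<open>F\<close> with total weight \<open>s\<close>, and the functional of \<open>F\<close>
  gives \<open>s \<le> 1\<close>. If \<open>s < 1\<close>, every segment from a point
  \<open>y\<close> of the hull to \<open>x\<close> can be prolonged beyond \<open>x\<close> inside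
  the hull, so \<open>G\<close> would be everything. Thus \<open>s = 1\<close>, and \<open>G\<close>
  and the hull of \<open>F\<close> share a relative interior point.\<close>

lemma proper_face_is_hull:
  assumes G: "G face_of convex hull \<Union>\<Gamma>" "G \<noteq> convex hull \<Union>\<Gamma>"
  shows "\<exists>F\<in>\<Gamma>. G = convex hull F"
proof (cases "G = {}")
  case True
  obtain F where "F \<in> \<Gamma>" using covering[OF subspace_0[OF subspace]] by blast
  then have "{} \<in> \<Gamma>" using down_closed by blast
  then show ?thesis using True by (intro bexI[of _ "{}"]) auto
next
  case False
  let ?P = "convex hull \<Union>\<Gamma>"
  have PW: "?P \<subseteq> W" using vertices subspace by (intro hull_minimal subspace_imp_convex)
  have GP: "G \<subseteq> ?P" using G face_of_imp_subset by blast
  obtain x where x: "x \<in> rel_interior G"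
    using False face_of_imp_convex[OF G(1)] rel_interior_eq_empty by blast
  then have xG: "x \<in> G" using rel_interior_subset by blast
  then have "x \<in> W" using GP PW by blast
  then obtain F c where F: "F \<in> \<Gamma>" "\<forall>v\<in>F. 0 < c v" "x = (\<Sum>v\<in>F. c v *\<^sub>R v)"
    using covering_positive by blast
  obtain a where a: "\<forall>v\<in>F. a \<bullet> v = 1" "\<forall>v\<in>\<Union>\<Gamma> - F. a \<bullet> v < 1"
    using support[OF F(1)] by blast
  define s where "s = sum c F"
  have "a \<bullet> x = s" using a F by (simp add: s_def inner_sum_right)
  moreover have "?P \<subseteq> {x. a \<bullet> x \<le> 1}"
  proof (intro hull_minimal convex_halfspace_le subsetI CollectI)
    fix v assume "v \<in> \<Union>\<Gamma>"
    then show "a \<bullet> v \<le> 1" using a by (cases "v \<in> F") (auto intro: less_imp_le)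
  qed
  ultimately have "s \<le> 1" using xG GP by auto
  moreover have "\<not> s < 1"
  proof
    assume "s < 1"
    have "y \<in> G" if y: "y \<in> ?P" for y
    proof (cases "y = x")
      case False
      have "x - y \<in> W" using y PW \<open>x \<in> W\<close> subspace by (auto intro: subspace_diff)
      then obtain F' c' where F': "F' \<in> \<Gamma>" "\<forall>v\<in>F'. 0 \<le> c' v" "x - y = (\<Sum>v\<in>F'. c' v *\<^sub>R v)"
        using covering by blast
      define s' where "s' = sum c' F'"
      have s': "0 \<le> s'" using F' by (simp add: s'_def sum_nonneg)
      \<comment> \<open>Small enough for the combined weight \<open>s + d * s'\<close> to stay at
        most 1; the 1 in the denominator covers \<open>s' = 0\<close>.\<close>
      define d where "d = (1 - s) / (1 + s')"
      have d: "0 < d" "s + d * s' \<le> 1"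
        using \<open>s < 1\<close> s' by (auto simp: d_def field_simps)
      define z where "z = x + d *\<^sub>R (x - y)"
      define b1 where "b1 v = (if v \<in> F then c v else 0)" for v
      define b2 where "b2 v = (if v \<in> F' then c' v else 0)" for v
      define b where "b v = b1 v + d * b2 v" for v
      have fin: "finite F" "finite F'" using F(1) F'(1) finite_face by auto
      have b1: "sum b1 (F \<union> F') = s" "(\<Sum>v\<in>F \<union> F'. b1 v *\<^sub>R v) = x"
        unfolding s_def F(3) using fin by (auto intro!: sum.mono_neutral_cong_right simp: b1_def)
      have b2: "sum b2 (F \<union> F') = s'" "(\<Sum>v\<in>F \<union> F'. b2 v *\<^sub>R v) = x - y"
        unfolding s'_def F'(3) using fin by (auto intro!: sum.mono_neutral_cong_right simp: b2_def)
      have "sum b (F \<union> F') = s + d * s'"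
        by (simp add: b_def sum.distrib b1 b2 flip: sum_distrib_left)
      moreover have "(\<Sum>v\<in>F \<union> F'. b v *\<^sub>R v) = z"
        by (simp add: b_def scaleR_add_left sum.distrib b1 b2 z_def
            flip: scaleR_scaleR scaleR_sum_right)
      moreover have "0 \<le> b v" for v
        using F(2) F'(2) d(1) by (simp add: b_def b1_def b2_def less_imp_le)
      moreover have "F \<union> F' \<subseteq> convex hull \<Union>\<Gamma>" using F(1) F'(1) by (auto intro: hull_inc)
      ultimately have "z \<in> ?P" using subconvex_in_hull[of "F \<union> F'" b] fin d(2) by simp
      moreover have "x \<in> open_segment y z"
      proof -
        have zy: "z - y = (1 + d) *\<^sub>R (x - y)" by (simp add: z_def algebra_simps)
        then have "z \<noteq> y" using False d(1) by auto
        moreover have "x = y + (1 / (1 + d)) *\<^sub>R (z - y)" using d(1) by (simp add: zy)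
        then have "x = (1 - 1 / (1 + d)) *\<^sub>R y + (1 / (1 + d)) *\<^sub>R z" by (simp add: algebra_simps)
        ultimately show ?thesis using d(1) unfolding in_segment
          by (intro conjI exI[of _ "1 / (1 + d)"]) auto
      qed
      ultimately show ?thesis using G(1) xG y unfolding face_of_def by blast
    qed (use xG in simp)
    then show False using G GP by blast
  qed
  ultimately have "s = 1" by simp
  have "x \<in> rel_interior (convex hull F)"
    using F \<open>s = 1\<close> by (auto simp: s_def rel_interior_convex_hull_explicit[OF
        independent_imp_affine_independent[OF independent_face[OF F(1)]]] intro!: exI[of _ c])
  then have "G = convex hull F"
    using face_of_eq[OF G(1) hull_face_of[OF F(1)]] x by blast
  then show ?thesis using F by blast
qed

lemma simplicial_polytope_hull: "simplicial_polytope (convex hull \<Union>\<Gamma>)"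
  unfolding simplicial_polytope_def
proof (intro conjI allI impI)
  show "polytope (convex hull \<Union>\<Gamma>)" using finite_vertices by (auto simp: polytope_def)
  fix G assume "G face_of convex hull \<Union>\<Gamma> \<and> G \<noteq> convex hull \<Union>\<Gamma>"
  then obtain F where F: "F \<in> \<Gamma>" "G = convex hull F" using proper_face_is_hull by blast
  \<comment> \<open>The empty face is the simplex of dimension -1.\<close>
  then show "\<exists>k. k simplex G"
    using independent_imp_affine_independent[OF independent_face[OF F(1)]]
    by (intro exI[of _ "int (card F) - 1"]) (auto simp: simplex_def)
qed

lemma boundary_complex_hull: "boundary_complex (convex hull \<Union>\<Gamma>) = \<Gamma>"
proof (intro equalityI subsetI)
  fix E assume "E \<in> boundary_complex (convex hull \<Union>\<Gamma>)"
  then obtain G where G: "G face_of convex hull \<Union>\<Gamma>" "G \<noteq> convex hull \<Union>\<Gamma>"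
    "E = {v. v extreme_point_of G}"
    unfolding boundary_complex_def by blast
  then obtain F where "F \<in> \<Gamma>" "G = convex hull F" using proper_face_is_hull by blast
  then show "E \<in> \<Gamma>" using G(3) extreme_points_hull by simp
next
  fix F assume "F \<in> \<Gamma>"
  then show "F \<in> boundary_complex (convex hull \<Union>\<Gamma>)"
    using hull_face_of hull_ne extreme_points_hull
    unfolding boundary_complex_def by (intro CollectI exI[of _ "convex hull F"]) simp
qed

text \<open>Covering makes the vertices span \<open>W\<close>, and the origin in the affine hull
  makes affine and linear dimension agree.\<close>

lemma aff_dim_hull: "aff_dim (convex hull \<Union>\<Gamma>) = int (dim W)"
proof -
  have "W \<subseteq> span (\<Union>\<Gamma>)"
  proof
    fix x assume "x \<in> W"
    then obtain F c where "F \<in> \<Gamma>" "x = (\<Sum>v\<in>F. c v *\<^sub>R v)" using covering by blast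
    then show "x \<in> span (\<Union>\<Gamma>)" by (simp, intro span_sum span_scale span_base UnionI)
  qed
  moreover have "span (\<Union>\<Gamma>) \<subseteq> W" using vertices subspace by (rule span_minimal)
  ultimately have "W = span (\<Union>\<Gamma>)" by (rule subset_antisym)
  then have "dim W = dim (\<Union>\<Gamma>)" using dim_span by simp
  moreover have "0 \<in> affine hull \<Union>\<Gamma>"
    by (rule subsetD[OF convex_hull_subset_affine_hull zero_in_hull])
  ultimately show ?thesis using aff_dim_zero[of "\<Union>\<Gamma>"] by (simp add: aff_dim_convex_hull)
qed

text \<open>The barycentre \<open>u\<close> of \<sigma> lies on the supporting hyperplanes of
  exactly the faces containing \<sigma>. Moving it out by the factor
  \<open>1 / (1 - \<theta>)\<close> crosses these hyperplanes and, for small \<theta>, no others.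
  The hyperplane of \<open>\<tau> \<union> \<sigma>\<close> is then tilted about \<tau> until it
  passes through the new vertex \<open>v\<close>.\<close>

lemma polytopal_fan_stellar_subdivision:
  assumes "\<sigma> \<in> \<Gamma>" "\<sigma> \<noteq> {}"
  shows "\<exists>v. v \<notin> \<Union>\<Gamma> \<and> polytopal_fan W (stellar_subdivision \<Gamma> \<sigma> v)"
proof -
  have "\<forall>F\<in>\<Gamma>. \<exists>a. (\<forall>v\<in>F. a \<bullet> v = 1) \<and> (\<forall>v\<in>\<Union>\<Gamma> - F. a \<bullet> v < 1)"
    using support by blast
  from bchoice[OF this] obtain a
    where a: "\<And>F v. F \<in> \<Gamma> \<Longrightarrow> v \<in> F \<Longrightarrow> a F \<bullet> v = 1"
      "\<And>F v. F \<in> \<Gamma> \<Longrightarrow> v \<in> \<Union>\<Gamma> - F \<Longrightarrow> a F \<bullet> v < 1" by blast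
  have a_le: "a F \<bullet> v \<le> 1" if "F \<in> \<Gamma>" "v \<in> \<Union>\<Gamma>" for F v
    using a[OF that(1), of v] that(2) by (cases "v \<in> F") (auto intro: less_imp_le)
  define k where "k = real (card \<sigma>)"
  have k: "k > 0" using assms finite_face by (simp add: k_def card_gt_0_iff)
  define u where "u = (1 / k) *\<^sub>R \<Sum>\<sigma>"
  have u_inner: "b \<bullet> u = (\<Sum>w\<in>\<sigma>. b \<bullet> w) / k" for b by (simp add: u_def inner_sum_right)
  have u1: "a F \<bullet> u = 1" if "F \<in> \<Gamma>" "\<sigma> \<subseteq> F" for F
  proof -
    have "(\<Sum>w\<in>\<sigma>. a F \<bullet> w) = (\<Sum>w\<in>\<sigma>. 1)" using a(1)[OF that(1)] that(2) by (intro sum.cong) auto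
    then show ?thesis using k by (simp add: u_inner k_def)
  qed
  have u2: "a F \<bullet> u < 1" if "F \<in> \<Gamma>" "\<not> \<sigma> \<subseteq> F" for F
  proof -
    obtain w where w: "w \<in> \<sigma>" "w \<notin> F" using \<open>\<not> \<sigma> \<subseteq> F\<close> by blast
    have "(\<Sum>w\<in>\<sigma>. a F \<bullet> w) < (\<Sum>w\<in>\<sigma>. 1)"
    proof (rule sum_strict_mono_ex1)
      show "finite \<sigma>" using finite_face assms by blast
      show "\<forall>x\<in>\<sigma>. a F \<bullet> x \<le> 1" using a_le[OF that(1)] assms by blast
      show "\<exists>x\<in>\<sigma>. a F \<bullet> x < 1" using a(2)[OF that(1), of w] w assms by blast
    qed
    then show ?thesis using k by (simp add: u_inner k_def)
  qed
  \<comment> \<open>These \<tau> give the new faces \<open>insert v \<tau>\<close>: they lie in the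
    star of \<sigma> without containing \<sigma>.\<close>
  define D where "D = {\<tau> \<in> \<Gamma>. \<not> \<sigma> \<subseteq> \<tau> \<and> \<tau> \<union> \<sigma> \<in> \<Gamma>}"
  have "\<exists>g. (\<forall>w\<in>\<tau>. g \<bullet> w = 0) \<and> (\<forall>w\<in>\<sigma> - \<tau>. g \<bullet> w > 0) \<and> g \<bullet> u = 1" if "\<tau> \<in> D" for \<tau>
  proof -
    define m where "m = real (card (\<sigma> - \<tau>))"
    have fin: "finite \<sigma>" using finite_face assms by blast
    have "\<sigma> - \<tau> \<noteq> {}" using that by (auto simp: D_def)
    then have m: "m > 0" using fin by (simp add: m_def card_gt_0_iff)
    have "independent (\<tau> \<union> \<sigma>)" using that independent_face by (simp add: D_def)
    \<comment> \<open>The value \<open>k / m\<close> on the \<open>m\<close> points of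
      \<open>\<sigma> - \<tau>\<close> averages to 1 over the \<open>k\<close> points of \<sigma>,
      that is, at \<open>u\<close>.\<close>
    from independent_functional[OF this, of "\<lambda>x. if x \<in> \<tau> then 0 else k / m"]
    obtain g where g: "\<forall>x\<in>\<tau> \<union> \<sigma>. g \<bullet> x = (if x \<in> \<tau> then 0 else k / m)" by blast
    have "(\<Sum>w\<in>\<sigma>. g \<bullet> w) = (\<Sum>w\<in>\<sigma> - \<tau>. k / m)"
      using g fin by (intro sum.mono_neutral_cong_right) auto
    also have "\<dots> = k" using m by (simp add: m_def)
    finally have "g \<bullet> u = 1" using k by (simp add: u_inner)
    then show ?thesis using g k m by (intro exI[of _ g]) auto
  qed
  then have "\<forall>\<tau>\<in>D. \<exists>g. (\<forall>w\<in>\<tau>. g \<bullet> w = 0) \<and> (\<forall>w\<in>\<sigma> - \<tau>. g \<bullet> w > 0) \<and> g \<bullet> u = 1" by blast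
  from bchoice[OF this] obtain g where g: "\<And>\<tau> w. \<tau> \<in> D \<Longrightarrow> w \<in> \<tau> \<Longrightarrow> g \<tau> \<bullet> w = 0"
    "\<And>\<tau> w. \<tau> \<in> D \<Longrightarrow> w \<in> \<sigma> - \<tau> \<Longrightarrow> g \<tau> \<bullet> w > 0" "\<And>\<tau>. \<tau> \<in> D \<Longrightarrow> g \<tau> \<bullet> u = 1" by blast
  have fin\<Gamma>: "finite \<Gamma>" using finite_vertices by (rule finite_UnionD)
  have lim: "\<forall>\<^sub>F \<theta> in at_right 0. p + \<theta> * q < 1" if "p < 1" for p q :: real
  proof -
    have "((\<lambda>\<theta>. p + \<theta> * q) \<longlongrightarrow> p + 0 * q) (at_right 0)" by (intro tendsto_intros)
    then show ?thesis using that by (intro order_tendstoD(2)) simp_all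
  qed
  \<comment> \<open>Apart from positivity, each requirement is shaped as
    \<open>p + \<theta> * q < 1\<close> with \<open>p < 1\<close>, even \<open>\<theta> < 1\<close>,
    so that \<open>lim\<close> applies; being finitely many, they hold together near 0.\<close>
  define P where "P \<theta> \<longleftrightarrow> 0 < \<theta> \<and> 0 + \<theta> * 1 < 1 \<and>
      (\<forall>F\<in>{F\<in>\<Gamma>. \<not> \<sigma> \<subseteq> F}. a F \<bullet> u + \<theta> * 1 < 1) \<and>
      (\<forall>\<tau>\<in>D. \<forall>w\<in>\<Union>\<Gamma> - (\<tau> \<union> \<sigma>). a (\<tau> \<union> \<sigma>) \<bullet> w + \<theta> * - (g \<tau> \<bullet> w) < 1)" for \<theta>
  have "\<forall>\<^sub>F \<theta> in at_right 0. P \<theta>"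
    unfolding P_def
  proof (intro eventually_conj eventually_ball_finite ballI lim)
    show "\<forall>\<^sub>F \<theta> in at_right (0::real). 0 < \<theta>" by (rule eventually_at_right_less)
    fix \<tau> w assume "\<tau> \<in> D" "w \<in> \<Union>\<Gamma> - (\<tau> \<union> \<sigma>)"
    then show "a (\<tau> \<union> \<sigma>) \<bullet> w < 1" using a(2)[of "\<tau> \<union> \<sigma>" w] by (simp add: D_def)
  qed (use fin\<Gamma> finite_vertices u2 in \<open>auto simp: D_def\<close>)
  from eventually_happens'[OF trivial_limit_at_right_real this] obtain \<theta> where "P \<theta>" ..
  then have \<theta>: "0 < \<theta>" "\<theta> < 1" "\<And>F. F \<in> \<Gamma> \<Longrightarrow> \<not> \<sigma> \<subseteq> F \<Longrightarrow> a F \<bullet> u < 1 - \<theta>"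
    "\<And>\<tau> w. \<tau> \<in> D \<Longrightarrow> w \<in> \<Union>\<Gamma> - (\<tau> \<union> \<sigma>) \<Longrightarrow> a (\<tau> \<union> \<sigma>) \<bullet> w - \<theta> * (g \<tau> \<bullet> w) < 1"
    unfolding P_def by (simp_all add: field_simps)
  define v where "v = (1 / (1 - \<theta>)) *\<^sub>R u"
  have v1: "a F \<bullet> v < 1" if "F \<in> \<Gamma>" "\<not> \<sigma> \<subseteq> F" for F
    using \<theta>(3)[OF that] \<theta>(2) by (simp add: v_def)
  have v2: "a F \<bullet> v = 1 / (1 - \<theta>)" if "F \<in> \<Gamma>" "\<sigma> \<subseteq> F" for F
    using u1[OF that] by (simp add: v_def)
  have v3: "g \<tau> \<bullet> v = 1 / (1 - \<theta>)" if "\<tau> \<in> D" for \<tau>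
    using g(3)[OF that] by (simp add: v_def)
  have vV: "v \<notin> \<Union>\<Gamma>"
  proof
    assume "v \<in> \<Union>\<Gamma>"
    then have "1 / (1 - \<theta>) \<le> 1" using a_le[OF assms(1)] v2[OF assms(1)] by force
    then show False using \<theta> by (simp add: field_simps)
  qed
  let ?S = "stellar_subdivision \<Gamma> \<sigma> v"
  have S: "?S = {F \<in> \<Gamma>. \<not> \<sigma> \<subseteq> F} \<union> insert v ` D"
    by (auto simp: stellar_subdivision_def D_def)
  have US: "\<Union>?S \<subseteq> insert v (\<Union>\<Gamma>)" by (auto simp: S D_def)
  have "\<Sum>\<sigma> \<in> W" using assms vertices subspace by (intro subspace_sum) auto
  then have vW: "v \<in> W" using subspace by (auto simp: v_def u_def intro: subspace_scale)
  have "polytopal_fan W ?S"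
    unfolding polytopal_fan_def
  proof (intro conjI ballI allI impI)
    show "finite (\<Union>?S)" using finite_subset[OF US] finite_vertices by simp
    show "\<Union>?S \<subseteq> W" using US vW vertices by blast
  next
    fix F F' assume F: "F \<in> ?S" "F' \<subseteq> F"
    show "F' \<in> ?S"
    proof (cases "F \<in> \<Gamma> \<and> \<not> \<sigma> \<subseteq> F")
      case True
      then show ?thesis using F down_closed[of F F'] by (auto simp: S)
    next
      case False
      then obtain \<tau> where \<tau>: "\<tau> \<in> D" "F = insert v \<tau>" using F by (auto simp: S)
      have *: "\<rho> \<in> D" if "\<rho> \<subseteq> \<tau>" for \<rho>
        using \<tau>(1) that down_closed[of \<tau> \<rho>] down_closed[of "\<tau> \<union> \<sigma>" "\<rho> \<union> \<sigma>"]
        unfolding D_def by blast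
      show ?thesis
      proof (cases "v \<in> F'")
        case True
        then have "F' = insert v (F' - {v})" "F' - {v} \<subseteq> \<tau>" using F \<tau> by auto
        then show ?thesis unfolding S using *[of "F' - {v}"] by blast
      next
        case False
        then have "F' \<subseteq> \<tau>" using F \<tau> by auto
        then show ?thesis using *[of F'] by (auto simp: S D_def)
      qed
    qed
  next
    fix F assume "F \<in> ?S"
    then consider "F \<in> \<Gamma>" "\<not> \<sigma> \<subseteq> F" | \<tau> where "\<tau> \<in> D" "F = insert v \<tau>" by (auto simp: S)
    then have "independent F \<and> (\<exists>b. (\<forall>v\<in>F. b \<bullet> v = 1) \<and> (\<forall>w\<in>insert v (\<Union>\<Gamma>) - F. b \<bullet> w < 1))"
    proof cases
      case 1
      have "a F \<bullet> w < 1" if "w \<in> insert v (\<Union>\<Gamma>) - F" for w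
        using a(2)[OF 1(1), of w] v1[OF 1] that by blast
      then show ?thesis using independent_face[OF 1(1)] a(1)[OF 1(1)] by blast
    next
      case (2 \<tau>)
      have \<tau>: "\<tau> \<in> \<Gamma>" "\<tau> \<union> \<sigma> \<in> \<Gamma>" using 2 by (auto simp: D_def)
      have "span \<tau> \<subseteq> {x. g \<tau> \<bullet> x = 0}"
        using g(1)[OF 2(1)] by (intro span_minimal subspace_hyperplane) auto
      then have "v \<notin> span \<tau>" using v3[OF 2(1)] \<theta> by auto
      then have "independent F" unfolding 2 using independent_face[OF \<tau>(1)] by (intro independent_insertI)
      \<comment> \<open>The tilted functional: at \<open>v\<close> it is
        \<open>1 / (1 - \<theta>) - \<theta> / (1 - \<theta>) = 1\<close>, on \<tau> it is still 1,
        and on \<open>\<sigma> - \<tau>\<close> it drops below 1 because \<open>g \<tau>\<close> is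
        positive there.\<close>
      moreover define b where "b = a (\<tau> \<union> \<sigma>) - \<theta> *\<^sub>R g \<tau>"
      have bi: "b \<bullet> w = a (\<tau> \<union> \<sigma>) \<bullet> w - \<theta> * (g \<tau> \<bullet> w)" for w
        by (simp add: b_def inner_diff_left)
      have "b \<bullet> v = 1"
        unfolding bi v3[OF 2(1)] v2[OF \<tau>(2) Un_upper2] using \<theta>(2) by (simp add: field_simps)
      then have "\<forall>w\<in>F. b \<bullet> w = 1" using 2 g(1) a(1)[OF \<tau>(2)] by (auto simp: bi)
      moreover have "b \<bullet> w < 1" if w: "w \<in> insert v (\<Union>\<Gamma>) - F" for w
      proof (cases "w \<in> \<sigma>")
        case True
        then show ?thesis using w 2 a(1)[OF \<tau>(2), of w] g(2)[OF 2(1), of w] \<theta>(1) by (simp add: bi)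
      next
        case False
        then show ?thesis using w 2 \<theta>(4)[OF 2(1), of w] by (simp add: bi)
      qed
      ultimately show ?thesis by blast
    qed
    then show "independent F" "\<exists>b. (\<forall>v\<in>F. b \<bullet> v = 1) \<and> (\<forall>w\<in>\<Union>?S - F. b \<bullet> w < 1)"
      using US by blast+
  next
    fix x assume "x \<in> W"
    then obtain F c where F: "F \<in> \<Gamma>" "\<forall>v\<in>F. 0 \<le> c v" "x = (\<Sum>v\<in>F. c v *\<^sub>R v)"
      using covering by blast
    show "\<exists>F\<in>?S. \<exists>c. (\<forall>v\<in>F. 0 \<le> c v) \<and> x = (\<Sum>v\<in>F. c v *\<^sub>R v)"
    proof (cases "\<sigma> \<subseteq> F")
      case False
      then show ?thesis using F by (auto simp: S)
    next
      case True
      have fin: "finite F" "finite \<sigma>" using finite_face F assms by auto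
      then have "Min (c ` \<sigma>) \<in> c ` \<sigma>" using assms(2) by simp
      \<comment> \<open>Removing the smallest coefficient from all of \<sigma> makes that of
        \<open>w0\<close> vanish, so the rest lies in the cone over \<open>F - {w0}\<close>, which
        no longer contains \<sigma>.\<close>
      then obtain w0 where w0: "w0 \<in> \<sigma>" "c w0 = Min (c ` \<sigma>)" by auto
      have min: "c w0 \<le> c w" if "w \<in> \<sigma>" for w using fin that w0(2) by simp
      define \<tau> where "\<tau> = F - {w0}"
      have "\<tau> \<union> \<sigma> = F" using True w0 by (auto simp: \<tau>_def)
      then have "\<tau> \<in> D" using F w0 down_closed[of F \<tau>] by (auto simp: D_def \<tau>_def)
      define c' where "c' y = c y - (if y \<in> \<sigma> then c w0 else 0)" for y
      have "(\<Sum>y\<in>F. c' y *\<^sub>R y) = x - (\<Sum>y\<in>F. (if y \<in> \<sigma> then c w0 else 0) *\<^sub>R y)"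
        by (simp add: c'_def F(3) scaleR_diff_left sum_subtractf)
      also have "(\<Sum>y\<in>F. (if y \<in> \<sigma> then c w0 else 0) *\<^sub>R y) = (\<Sum>y\<in>\<sigma>. c w0 *\<^sub>R y)"
        using fin True by (intro sum.mono_neutral_cong_right) auto
      \<comment> \<open>\<open>\<Sum>\<sigma>\<close> is \<open>k\<close> times \<open>u\<close>,
        and \<open>u\<close> is \<open>1 - \<theta>\<close> times \<open>v\<close>.\<close>
      also have "\<dots> = (c w0 * k * (1 - \<theta>)) *\<^sub>R v"
        using k \<theta> by (simp add: v_def u_def scaleR_sum_right)
      finally have "x = (c w0 * k * (1 - \<theta>)) *\<^sub>R v + (\<Sum>y\<in>F. c' y *\<^sub>R y)" by simp
      also have "(\<Sum>y\<in>F. c' y *\<^sub>R y) = (\<Sum>y\<in>\<tau>. c' y *\<^sub>R y)"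
        using fin w0 by (intro sum.mono_neutral_right) (auto simp: \<tau>_def c'_def)
      also have "(c w0 * k * (1 - \<theta>)) *\<^sub>R v + \<dots>
          = (\<Sum>y\<in>insert v \<tau>. (c'(v := c w0 * k * (1 - \<theta>))) y *\<^sub>R y)"
      proof -
        have "v \<notin> \<tau>" "finite \<tau>" using vV F(1) fin by (auto simp: \<tau>_def)
        moreover from this have "(\<Sum>y\<in>\<tau>. (c'(v := t)) y *\<^sub>R y) = (\<Sum>y\<in>\<tau>. c' y *\<^sub>R y)" for t
          by (intro sum.cong) auto
        ultimately show ?thesis by simp
      qed
      finally have x: "x = \<dots>" .
      have "c w0 \<ge> 0" using F(2) w0(1) True by blast
      then have "\<forall>y\<in>insert v \<tau>. 0 \<le> (c'(v := c w0 * k * (1 - \<theta>))) y"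
        using F(2) min k \<theta> by (auto simp: c'_def \<tau>_def)
      then show ?thesis using x \<open>\<tau> \<in> D\<close> unfolding S by blast
    qed
  qed (use subspace nontrivial in auto)
  then show ?thesis using vV by blast
qed

end

section \<open>The crosspolytope\<close>

text \<open>The crosspolytope boundary with \<open>(i, 1)\<close> and \<open>(i, - 1)\<close> as
  antipodal vertices. Taking graphs of sign functions as faces builds in the exclusion of antipodal
  pairs and matches the common sign vector of a signed chain.\<close>

definition cross_complex :: "'a set \<Rightarrow> ('a \<times> int) set set" where
  "cross_complex J = {(\<lambda>i. (i, \<epsilon> i)) ` \<tau> | \<tau> \<epsilon>. \<tau> \<subseteq> J \<and> (\<forall>i\<in>J. \<epsilon> i \<in> {1, - 1})}"

lemma Union_cross_complex: "\<Union>(cross_complex J) \<subseteq> J \<times> {1, - 1}"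
  by (auto simp: cross_complex_def)

lemma cross_complex_isomorphic_crosspolytope:
  assumes "finite J"
  shows "complex_isomorphic (cross_complex J) (crosspolytope_boundary (card J))"
proof -
  obtain b where b: "bij_betw b J {1..card J}"
    using assms finite_same_card_bij[of J "{1..card J}"] by auto
  then have inj: "inj_on b J" and im: "b ` J = {1..card J}" by (auto simp: bij_betw_def)
  have pos: "0 < b i \<and> b i \<le> card J" if "i \<in> J" for i
    using im that by fastforce
  let ?f = "\<lambda>(i, s). s * int (b i)"
  show ?thesis
  proof (rule complex_isomorphicI)
    have "inj_on ?f (J \<times> {1, - 1})"
      using pos inj by (fastforce simp: inj_on_def)
    then show "inj_on ?f (\<Union>(cross_complex J))"
      using Union_cross_complex by (rule inj_on_subset)
    show "(\<lambda>\<tau>. ?f ` \<tau>) ` cross_complex J = crosspolytope_boundary (card J)"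
    proof (intro equalityI subsetI)
      fix T assume "T \<in> (\<lambda>\<tau>. ?f ` \<tau>) ` cross_complex J"
      then obtain \<tau> \<epsilon> where T: "T = (\<lambda>i. \<epsilon> i * int (b i)) ` \<tau>" "\<tau> \<subseteq> J" "\<forall>i\<in>J. \<epsilon> i \<in> {1, - 1}"
        by (auto simp: cross_complex_def image_image)
      have "\<not> (k \<in> T \<and> - k \<in> T)" for k
      proof
        assume "k \<in> T \<and> - k \<in> T"
        then obtain i j where ij: "i \<in> J" "j \<in> J" "k = \<epsilon> i * int (b i)" "- k = \<epsilon> j * int (b j)"
          using T by auto
        then have "b i = b j" using T(3)[rule_format, of i] T(3)[rule_format, of j] by auto
        then have "i = j" using ij inj by (auto simp: inj_on_def)
        then show False using ij T(3)[rule_format, of i] pos[of i] by auto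
      qed
      moreover have "k \<noteq> 0 \<and> \<bar>k\<bar> \<le> int (card J)" if "k \<in> T" for k
      proof -
        obtain i where i: "i \<in> J" "k = \<epsilon> i * int (b i)" using T \<open>k \<in> T\<close> by auto
        then show ?thesis using pos[of i] T(3)[rule_format, of i] by auto
      qed
      ultimately show "T \<in> crosspolytope_boundary (card J)"
        by (auto simp: crosspolytope_boundary_def)
    next
      fix T assume "T \<in> crosspolytope_boundary (card J)"
      then have T: "\<And>k. k \<in> T \<Longrightarrow> k \<noteq> 0 \<and> \<bar>k\<bar> \<le> int (card J)" "\<And>k. k \<in> T \<Longrightarrow> - k \<notin> T"
        by (auto simp: crosspolytope_boundary_def)
      define \<tau> where "\<tau> = {i\<in>J. int (b i) \<in> T \<or> - int (b i) \<in> T}"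
      \<comment> \<open>For \<open>i\<close> in \<tau> the sign is forced, as \<open>T\<close> has
        no antipodal pair; off \<tau> the value \<open>- 1\<close> is a default.\<close>
      define \<epsilon> where "\<epsilon> i = (if int (b i) \<in> T then 1 else - 1 :: int)" for i
      have "T = (\<lambda>i. \<epsilon> i * int (b i)) ` \<tau>"
      proof (intro equalityI subsetI)
        fix k assume k: "k \<in> T"
        then have "nat \<bar>k\<bar> \<in> b ` J" using T(1)[of k] unfolding im by auto
        then obtain i where i: "i \<in> J" "int (b i) = \<bar>k\<bar>" by (metis abs_ge_zero imageE int_nat_eq)
        show "k \<in> (\<lambda>i. \<epsilon> i * int (b i)) ` \<tau>"
        proof (cases "k > 0")
          case True
          then show ?thesis using i k by (intro image_eqI[of _ _ i]) (auto simp: \<epsilon>_def \<tau>_def)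
        next
          case False
          then show ?thesis using i k T(2)[of k]
            by (intro image_eqI[of _ _ i]) (auto simp: \<epsilon>_def \<tau>_def)
        qed
      qed (auto simp: \<epsilon>_def \<tau>_def)
      then have "T = ?f ` (\<lambda>i. (i, \<epsilon> i)) ` \<tau>" by (simp add: image_image)
      moreover have "\<tau> \<subseteq> J" "\<forall>i\<in>J. \<epsilon> i \<in> {1, - 1}" by (auto simp: \<epsilon>_def \<tau>_def)
      then have "(\<lambda>i. (i, \<epsilon> i)) ` \<tau> \<in> cross_complex J" unfolding cross_complex_def by blast
      ultimately show "T \<in> (\<lambda>\<tau>. ?f ` \<tau>) ` cross_complex J" by blast
    qed
  qed
qed

text \<open>The regular crosspolytope in the coordinate subspace of \<open>J\<close>; its cones are
  the faces of the coordinate orthants.\<close>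

lemma cross_complex_polytopal:
  fixes J :: "'a::finite set"
  assumes "J \<noteq> {}"
  shows "\<exists>\<Gamma> W :: (real, 'a) vec set. polytopal_fan W \<Gamma> \<and> dim W = card J \<and>
    complex_isomorphic (cross_complex J) \<Gamma>"
proof -
  let ?e = "\<lambda>i. axis i 1 :: (real, 'a) vec"
  define W where "W = span (?e ` J)"
  define f where "f = (\<lambda>(i, s). of_int s *\<^sub>R ?e i)"
  define \<Gamma> where "\<Gamma> = (\<lambda>\<tau>. f ` \<tau>) ` cross_complex J"
  have inj_e: "inj ?e" by (auto simp: inj_on_def axis_eq_axis)
  have "independent (?e ` J)"
    by (rule independent_mono[OF independent_Basis]) (auto simp: axis_in_Basis_iff)
  then have dimW: "dim W = card J"
    using inj_e by (simp add: W_def dim_eq_card_independent card_image inj_on_subset)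
  have supp: "x $ j = 0" if "x \<in> W" "j \<notin> J" for x j
  proof -
    have "W \<subseteq> {x. x $ j = 0}"
      unfolding W_def using that(2)
      by (intro span_minimal) (auto simp: axis_def subspace_def)
    then show ?thesis using that by blast
  qed
  have \<Gamma>E: "\<exists>\<tau> \<epsilon>. F = (\<lambda>i. of_int (\<epsilon> i) *\<^sub>R ?e i) ` \<tau> \<and> \<tau> \<subseteq> J \<and> (\<forall>i\<in>J. \<epsilon> i \<in> {1, - 1})"
    if "F \<in> \<Gamma>" for F
  proof -
    obtain \<tau> \<epsilon> where "F = f ` (\<lambda>i. (i, \<epsilon> i)) ` \<tau>" "\<tau> \<subseteq> J" "\<forall>i\<in>J. \<epsilon> i \<in> {1, - 1}"
      using \<open>F \<in> \<Gamma>\<close> unfolding \<Gamma>_def cross_complex_def by blast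
    then show ?thesis by (intro exI[of _ \<tau>] exI[of _ \<epsilon>]) (simp add: f_def image_image)
  qed
  have \<Gamma>I: "(\<lambda>i. of_int (\<epsilon> i) *\<^sub>R ?e i) ` \<tau> \<in> \<Gamma>" if "\<tau> \<subseteq> J" "\<forall>i\<in>J. \<epsilon> i \<in> {1, - 1}" for \<tau> \<epsilon>
  proof -
    have "(\<lambda>i. (i, \<epsilon> i)) ` \<tau> \<in> cross_complex J" using that by (auto simp: cross_complex_def)
    then have "f ` (\<lambda>i. (i, \<epsilon> i)) ` \<tau> \<in> \<Gamma>" unfolding \<Gamma>_def by (rule imageI)
    then show ?thesis by (simp add: f_def image_image)
  qed
  have U: "\<Union>\<Gamma> \<subseteq> f ` (J \<times> {1, - 1})"
    using Union_cross_complex[of J] unfolding \<Gamma>_def by blast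
  have "inj_on f (J \<times> {1, - 1})"
    by (auto simp: f_def inj_on_def vec_eq_iff axis_def split: if_splits)
  then have "inj_on f (\<Union>(cross_complex J))" using Union_cross_complex by (rule inj_on_subset)
  then have iso: "complex_isomorphic (cross_complex J) \<Gamma>"
    unfolding \<Gamma>_def by (intro complex_isomorphicI) auto
  have "polytopal_fan W \<Gamma>"
    unfolding polytopal_fan_def
  proof (intro conjI ballI allI impI)
    show "subspace W" by (simp add: W_def)
    show "W \<noteq> {0}" using assms dimW by (auto simp: card_eq_0_iff)
    show "finite (\<Union>\<Gamma>)" using U by (rule finite_subset) simp
    show "\<Union>\<Gamma> \<subseteq> W"
      using U by (rule order_trans) (auto simp: f_def W_def span_base span_neg)
  next
    fix F F' assume F: "F \<in> \<Gamma>" "F' \<subseteq> F"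
    then obtain \<tau> \<epsilon> where \<tau>: "F = (\<lambda>i. of_int (\<epsilon> i) *\<^sub>R ?e i) ` \<tau>" "\<tau> \<subseteq> J" "\<forall>i\<in>J. \<epsilon> i \<in> {1, - 1}"
      using \<Gamma>E by blast
    then obtain \<tau>' where "\<tau>' \<subseteq> \<tau>" "F' = (\<lambda>i. of_int (\<epsilon> i) *\<^sub>R ?e i) ` \<tau>'"
      using F(2) by (auto simp: subset_image_iff)
    then show "F' \<in> \<Gamma>" using \<tau> \<Gamma>I[of \<tau>' \<epsilon>] by blast
  next
    fix F assume "F \<in> \<Gamma>"
    then obtain \<tau> \<epsilon> where \<tau>: "F = (\<lambda>i. of_int (\<epsilon> i) *\<^sub>R ?e i) ` \<tau>" "\<tau> \<subseteq> J" "\<forall>i\<in>J. \<epsilon> i \<in> {1, - 1}"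
      using \<Gamma>E by blast
    show "independent F"
    proof (rule pairwise_orthogonal_independent)
      show "pairwise orthogonal F"
        unfolding \<tau> pairwise_def by (auto simp: orthogonal_def inner_axis_axis)
      show "0 \<notin> F" using \<tau> by (fastforce simp: axis_eq_0_iff)
    qed
    \<comment> \<open>At the vertex with coordinate \<open>i\<close> and sign \<open>s\<close> this
      gives \<open>\<epsilon> i * s\<close> if \<open>i \<in> \<tau>\<close> and 0 otherwise: 1 on
      \<open>F\<close>, and 0 or -1 at all other vertices.\<close>
    define b :: "(real, 'a) vec" where "b = (\<chi> i. if i \<in> \<tau> then of_int (\<epsilon> i) else 0)"
    have b: "b \<bullet> f (i, s) = (if i \<in> \<tau> then of_int (\<epsilon> i * s) else 0)" for i s
      by (simp add: f_def b_def inner_axis)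
    show "\<exists>a. (\<forall>v\<in>F. a \<bullet> v = 1) \<and> (\<forall>v\<in>\<Union>\<Gamma> - F. a \<bullet> v < 1)"
    proof (intro exI[of _ b] conjI ballI)
      fix v assume "v \<in> F"
      then obtain i where i: "i \<in> \<tau>" "v = f (i, \<epsilon> i)" using \<tau> by (auto simp: f_def)
      then have "\<epsilon> i = 1 \<or> \<epsilon> i = - 1" using \<tau> by auto
      then show "b \<bullet> v = 1" using i b[of i "\<epsilon> i"] by auto
    next
      fix v assume v: "v \<in> \<Union>\<Gamma> - F"
      then obtain i s where i: "i \<in> J" "s \<in> {1, - 1}" "v = f (i, s)" using U by blast
      show "b \<bullet> v < 1"
      proof (cases "i \<in> \<tau>")
        case True
        then have "s \<noteq> \<epsilon> i" using v i \<tau> by (auto simp: f_def)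
        then show ?thesis using i \<tau>(3) b[of i s] by auto
      qed (use i b in simp)
    qed
  next
    fix x assume x: "x \<in> W"
    define \<epsilon> where "\<epsilon> i = (if x $ i \<ge> 0 then 1 else - 1 :: int)" for i
    let ?g = "\<lambda>i. of_int (\<epsilon> i) *\<^sub>R ?e i"
    have "inj_on ?g J" by (auto simp: \<epsilon>_def inj_on_def vec_eq_iff axis_def split: if_splits)
    \<comment> \<open>Coefficients must be a function of the vertex, hence
      \<open>\<bar>x \<bullet> v\<bar>\<close> instead of the absolute value of a
      coordinate.\<close>
    then have "(\<Sum>v\<in>?g ` J. \<bar>x \<bullet> v\<bar> *\<^sub>R v) = (\<Sum>i\<in>J. \<bar>x \<bullet> ?g i\<bar> *\<^sub>R ?g i)"
      by (simp add: sum.reindex)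
    also have "\<dots> = (\<Sum>i\<in>J. x $ i *\<^sub>R ?e i)"
      by (intro sum.cong) (auto simp: \<epsilon>_def inner_axis)
    also have "\<dots> = x"
      using supp[OF x] by (auto simp: vec_eq_iff axis_def if_distrib cong: if_cong)
    finally show "\<exists>F\<in>\<Gamma>. \<exists>c. (\<forall>v\<in>F. 0 \<le> c v) \<and> x = (\<Sum>v\<in>F. c v *\<^sub>R v)"
      using \<Gamma>I[of J \<epsilon>] by (intro bexI[of _ "?g ` J"] exI[of _ "\<lambda>v. \<bar>x \<bullet> v\<bar>"]) (auto simp: \<epsilon>_def)
  qed
  then show ?thesis using dimW iso by blast
qed

section \<open>Partially subdivided crosspolytopes\<close>

definition signed_vertices :: "('a::complete_lattice \<times> ('a \<Rightarrow> int)) set set" where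
  "signed_vertices = (\<lambda>(x, \<epsilon>). signed_vertex x \<epsilon>) ` ((UNIV - {bot}) \<times> sign_vectors)"

abbreviation signed_graph :: "'a set \<Rightarrow> ('a \<Rightarrow> int) \<Rightarrow> ('a \<times> int) set" where
  "signed_graph \<tau> \<epsilon> \<equiv> (\<lambda>i. (i, \<epsilon> i)) ` \<tau>"

text \<open>The complex reached when the faces of the crosspolytope belonging to the vertices in \<open>S\<close>
  have been subdivided: a signed chain in \<open>S\<close>, together with crosspolytope vertices
  below the chain that do not span an element already subdivided.\<close>

definition partial_pm ::
  "('a::complete_lattice \<times> ('a \<Rightarrow> int)) set set \<Rightarrow> ('a \<times> int + ('a \<times> ('a \<Rightarrow> int)) set) set set" where
  "partial_pm S = {signed_graph \<tau> \<epsilon> <+> signed_face \<sigma> \<epsilon> | \<sigma> \<tau> \<epsilon>.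
     \<epsilon> \<in> sign_vectors \<and> \<sigma> \<in> order_complex (UNIV - {bot}) \<and> \<tau> \<subseteq> {j. join_irreducible j} \<and>
     signed_face \<sigma> \<epsilon> \<subseteq> S \<and> (\<forall>y\<in>\<sigma>. Sup \<tau> \<le> y) \<and> signed_vertex (Sup \<tau>) \<epsilon> \<notin> S}"

lemma partial_pmI:
  assumes "\<epsilon> \<in> sign_vectors" "\<sigma> \<in> order_complex (UNIV - {bot})" "\<tau> \<subseteq> {j. join_irreducible j}"
    "signed_face \<sigma> \<epsilon> \<subseteq> S" "\<And>y. y \<in> \<sigma> \<Longrightarrow> Sup \<tau> \<le> y" "signed_vertex (Sup \<tau>) \<epsilon> \<notin> S"
  shows "signed_graph \<tau> \<epsilon> <+> signed_face \<sigma> \<epsilon> \<in> partial_pm S"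
  unfolding partial_pm_def using assms by blast

lemma partial_pmE:
  assumes "F \<in> partial_pm S"
  obtains \<sigma> \<tau> \<epsilon> where "F = signed_graph \<tau> \<epsilon> <+> signed_face \<sigma> \<epsilon>"
    "\<epsilon> \<in> sign_vectors" "\<sigma> \<in> order_complex (UNIV - {bot})" "\<tau> \<subseteq> {j. join_irreducible j}"
    "signed_face \<sigma> \<epsilon> \<subseteq> S" "\<forall>y\<in>\<sigma>. Sup \<tau> \<le> y" "signed_vertex (Sup \<tau>) \<epsilon> \<notin> S"
  using assms unfolding partial_pm_def by blast

section \<open>Disjoint unions of vertex sets, chains, and classes of signed elements\<close>

lemma Plus_eq_iff: "A <+> B = C <+> D \<longleftrightarrow> A = C \<and> B = D"
  by (auto simp: Plus_def set_eq_iff image_iff)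

lemma Un_Plus: "(A <+> B) \<union> (C <+> D) = (A \<union> C) <+> (B \<union> D)"
  by (auto simp: Plus_def)

lemma Plus_subset_iff: "A <+> B \<subseteq> C <+> D \<longleftrightarrow> A \<subseteq> C \<and> B \<subseteq> D"
  by (auto simp: Plus_def)

lemma order_complex_subset: "\<sigma> \<in> order_complex V \<Longrightarrow> \<sigma>' \<subseteq> \<sigma> \<Longrightarrow> \<sigma>' \<in> order_complex V"
  by (auto simp: order_complex_def intro: finite_subset chain_subset)

lemma order_complex_insert:
  "\<sigma> \<in> order_complex V \<Longrightarrow> x \<in> V \<Longrightarrow> (\<And>y. y \<in> \<sigma> \<Longrightarrow> x \<le> y) \<Longrightarrow> insert x \<sigma> \<in> order_complex V"
  by (auto simp: order_complex_def chain_def)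

lemma empty_in_order_complex [simp]: "{} \<in> order_complex V"
  by (auto simp: order_complex_def chain_def)

lemma signed_vertex_eq_iff:
  assumes "x \<noteq> bot" "\<epsilon> \<in> sign_vectors" "\<delta> \<in> sign_vectors"
  shows "signed_vertex y \<epsilon> = signed_vertex x \<delta> \<longleftrightarrow> y = x \<and> (\<forall>j\<in>lattice_ext x. \<epsilon> j = \<delta> j)"
proof
  assume eq: "signed_vertex y \<epsilon> = signed_vertex x \<delta>"
  have "(x, \<delta>) \<in> signed_vertex x \<delta>" using assms by (simp add: signed_vertex_def sign_rel_def)
  then have "(x, \<delta>) \<in> signed_vertex y \<epsilon>" using eq by simp
  then show "y = x \<and> (\<forall>j\<in>lattice_ext x. \<epsilon> j = \<delta> j)" by (auto simp: signed_vertex_def sign_rel_def)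
qed (use assms in \<open>auto simp: signed_vertex_def sign_rel_def\<close>)

text \<open>For \<open>bot\<close> the class is empty, as no pair involving \<open>bot\<close> is related to anything.\<close>

lemma signed_vertex_in_signed_vertices:
  assumes "\<epsilon> \<in> sign_vectors"
  shows "signed_vertex x \<epsilon> \<in> signed_vertices \<longleftrightarrow> x \<noteq> bot"
proof
  assume "signed_vertex x \<epsilon> \<in> signed_vertices"
  then obtain y \<delta> where "y \<noteq> bot" "\<delta> \<in> sign_vectors" "signed_vertex x \<epsilon> = signed_vertex y \<delta>"
    by (auto simp: signed_vertices_def)
  then show "x \<noteq> bot" using signed_vertex_eq_iff[of y \<epsilon> \<delta> x] assms by auto
qed (use assms in \<open>auto simp: signed_vertices_def\<close>)

lemma finite_signed_vertices: "finite (signed_vertices :: ('a::{finite, complete_lattice} \<times> _) set set)"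
  unfolding signed_vertices_def sign_vectors_def
  by (intro finite_imageI finite_cartesian_product finite_PiE) auto

context
  assumes md: "meet_distributive TYPE('a::{finite, complete_lattice})"
begin

text \<open>The same face can arise from different sign vectors. Since the extreme points of
  \<open>Sup \<tau>\<close> lie in \<tau>, the test on \<open>Sup \<tau>\<close> in
  \<open>partial_pm\<close> sees only the signs on \<tau>.\<close>

lemma signed_vertex_Sup_cong:
  fixes \<tau> :: "'a set"
  assumes "\<tau> \<subseteq> {j. join_irreducible j}" "\<epsilon> \<in> sign_vectors" "\<delta> \<in> sign_vectors" "\<forall>i\<in>\<tau>. \<epsilon> i = \<delta> i"
  shows "signed_vertex (Sup \<tau>) \<epsilon> = signed_vertex (Sup \<tau>) \<delta>"
proof (cases "Sup \<tau> = bot")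
  case True
  then show ?thesis by (auto simp: signed_vertex_def sign_rel_def)
next
  case False
  have "lattice_ext (Sup \<tau>) \<subseteq> \<tau>" using lattice_ext_least_generating(3)[OF md assms(1)] by simp
  then show ?thesis using signed_vertex_eq_iff[OF False] assms by blast
qed

text \<open>By \<open>above\<close>, a face that contains the signed extreme points of
  \<open>x\<close> has crosspolytope vertices with join exactly \<open>x\<close>, so its chain lies
  above \<open>x\<close>. Conversely, \<open>below\<close> makes \<open>x\<close> the least element
  of every chain with the new vertex. Hence the new vertex extends chains only at the
  bottom.\<close>

lemma partial_pm_insert:
  fixes S :: "('a \<times> ('a \<Rightarrow> int)) set set"
  assumes x: "x \<noteq> bot" and \<delta>: "\<delta> \<in> sign_vectors" and new: "signed_vertex x \<delta> \<notin> S"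
    and above: "\<And>y \<epsilon>. x < y \<Longrightarrow> \<epsilon> \<in> sign_vectors \<Longrightarrow> signed_vertex y \<epsilon> \<in> S"
    and below: "\<And>y \<epsilon>. y < x \<Longrightarrow> \<epsilon> \<in> sign_vectors \<Longrightarrow> signed_vertex y \<epsilon> \<notin> S"
  shows "stellar_step (partial_pm S) (partial_pm (insert (signed_vertex x \<delta>) S))"
proof -
  define v0 where "v0 = signed_vertex x \<delta>"
  define \<rho> :: "('a \<times> int + ('a \<times> ('a \<Rightarrow> int)) set) set" where "\<rho> = signed_graph (lattice_ext x) \<delta> <+> {}"
  have ext: "Sup (lattice_ext x) = x" "lattice_ext x \<subseteq> {j. join_irreducible j}"
    using lattice_ext_least_generating(1,2)[OF md, of x] by (auto simp: irreducibles_below_def)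
  have eq_v0: "signed_vertex y \<epsilon> = v0 \<longleftrightarrow> y = x \<and> (\<forall>j\<in>lattice_ext x. \<epsilon> j = \<delta> j)"
    if "\<epsilon> \<in> sign_vectors" for y \<epsilon>
    unfolding v0_def using signed_vertex_eq_iff[OF x that \<delta>] .
  have \<rho>_sub: "\<rho> \<subseteq> signed_graph \<tau> \<epsilon> <+> B \<longleftrightarrow> lattice_ext x \<subseteq> \<tau> \<and> (\<forall>j\<in>lattice_ext x. \<epsilon> j = \<delta> j)"
    for \<tau> \<epsilon> and B :: "('a \<times> ('a \<Rightarrow> int)) set set"
    unfolding \<rho>_def Plus_subset_iff by auto
  have \<rho>_iff: "\<rho> \<subseteq> signed_graph \<tau> \<epsilon> <+> B \<longleftrightarrow> signed_vertex (Sup \<tau>) \<epsilon> = v0"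
    if "\<tau> \<subseteq> {j. join_irreducible j}" "\<epsilon> \<in> sign_vectors" "signed_vertex (Sup \<tau>) \<epsilon> \<notin> S"
    for \<tau> \<epsilon> and B :: "('a \<times> ('a \<Rightarrow> int)) set set"
    unfolding \<rho>_sub eq_v0[OF that(2)]
  proof (intro iffI conjI; elim conjE)
    assume "lattice_ext x \<subseteq> \<tau>"
    then have "x \<le> Sup \<tau>" using ext(1) Sup_subset_mono by metis
    then show "Sup \<tau> = x" using above[OF _ that(2)] that(3) by (auto simp: le_less)
  next
    assume "Sup \<tau> = x"
    then show "lattice_ext x \<subseteq> \<tau>" using lattice_ext_least_generating(3)[OF md that(1)] by simp
  qed simp_all
  have \<rho>_face: "\<rho> \<in> partial_pm S"
    using partial_pmI[of \<delta> "{}" "lattice_ext x" S] ext new \<delta> by (simp add: \<rho>_def signed_face_def)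
  have "lattice_ext x \<noteq> {}" using ext(1) x by auto
  then have \<rho>_ne: "\<rho> \<noteq> {}" by (auto simp: \<rho>_def)
  have v_new: "Inr v0 \<notin> \<Union>(partial_pm S)"
    using new by (auto elim!: partial_pmE simp: v0_def)
  have "partial_pm (insert v0 S) = stellar_subdivision (partial_pm S) \<rho> (Inr v0)"
  proof (intro equalityI subsetI)
    fix G assume "G \<in> partial_pm (insert v0 S)"
    then obtain \<sigma> \<tau> \<epsilon> where G: "G = signed_graph \<tau> \<epsilon> <+> signed_face \<sigma> \<epsilon>"
      "\<epsilon> \<in> sign_vectors" "\<sigma> \<in> order_complex (UNIV - {bot})" "\<tau> \<subseteq> {j. join_irreducible j}"
      "signed_face \<sigma> \<epsilon> \<subseteq> insert v0 S" "\<forall>y\<in>\<sigma>. Sup \<tau> \<le> y" "signed_vertex (Sup \<tau>) \<epsilon> \<notin> insert v0 S"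
      by (rule partial_pmE)
    have not_\<rho>: "\<not> \<rho> \<subseteq> signed_graph \<tau> \<epsilon> <+> B" for B
      using \<rho>_iff[OF G(4,2)] G(7) by blast
    show "G \<in> stellar_subdivision (partial_pm S) \<rho> (Inr v0)"
    proof (cases "v0 \<in> signed_face \<sigma> \<epsilon>")
      case False
      then have "signed_face \<sigma> \<epsilon> \<subseteq> S" using G(5) by blast
      then have "G \<in> partial_pm S" unfolding G(1) using G by (intro partial_pmI) auto
      then show ?thesis using not_\<rho> G(1) by (auto simp: stellar_subdivision_def)
    next
      case True
      then obtain y where y: "y \<in> \<sigma>" "signed_vertex y \<epsilon> = v0" by (auto simp: signed_face_def)
      then have x\<sigma>: "x \<in> \<sigma>" and agree: "\<forall>j\<in>lattice_ext x. \<epsilon> j = \<delta> j"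
        unfolding eq_v0[OF G(2)] by auto
      have v0_eq: "signed_vertex x \<epsilon> = v0" using eq_v0[OF G(2)] agree by blast
      \<comment> \<open>\<open>F\<close> will be \<open>G\<close> without the new vertex; adding
        \<rho> to it makes the join of the crosspolytope part exactly \<open>x\<close>.\<close>
      define \<sigma>' where "\<sigma>' = \<sigma> - {x}"
      define F where "F = signed_graph \<tau> \<epsilon> <+> signed_face \<sigma>' \<epsilon>"
      have \<sigma>': "\<sigma>' \<in> order_complex (UNIV - {bot})"
        using G(3) by (rule order_complex_subset) (auto simp: \<sigma>'_def)
      have face': "signed_face \<sigma>' \<epsilon> \<subseteq> S"
        using G(5) eq_v0[OF G(2)] by (auto simp: signed_face_def \<sigma>'_def)
      have "F \<in> partial_pm S"
        unfolding F_def using G \<sigma>' face' by (intro partial_pmI) (auto simp: \<sigma>'_def)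
      moreover have "G = F \<union> {Inr v0}"
      proof -
        have "signed_face \<sigma> \<epsilon> = insert v0 (signed_face \<sigma>' \<epsilon>)"
          using x\<sigma> v0_eq by (auto simp: signed_face_def \<sigma>'_def)
        then show ?thesis unfolding G(1) F_def by auto
      qed
      moreover have "F \<union> \<rho> \<in> partial_pm S"
      proof -
        have gr: "signed_graph (lattice_ext x) \<delta> = signed_graph (lattice_ext x) \<epsilon>"
          using agree by (intro image_cong) auto
        have "F \<union> \<rho> = signed_graph (\<tau> \<union> lattice_ext x) \<epsilon> <+> signed_face \<sigma>' \<epsilon>"
          unfolding F_def \<rho>_def Un_Plus gr by (simp add: image_Un)
        moreover have "Sup (\<tau> \<union> lattice_ext x) = x"
          using G(6) x\<sigma> ext(1) by (simp add: Sup_union_distrib sup_absorb2)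
        moreover have "x \<le> y" if "y \<in> \<sigma>'" for y
        proof -
          have "x \<le> y \<or> y \<le> x"
            using G(3) x\<sigma> that by (auto simp: order_complex_def \<sigma>'_def dest: chainD)
          moreover have "\<not> y < x" using below[OF _ G(2)] face' that by (auto simp: signed_face_def)
          ultimately show ?thesis by (auto simp: le_less)
        qed
        ultimately show ?thesis
          using partial_pmI[OF G(2) \<sigma>' _ face', of "\<tau> \<union> lattice_ext x"] G(4) ext(2) v0_eq new
          by (simp add: v0_def)
      qed
      moreover have "\<not> \<rho> \<subseteq> F" unfolding F_def by (rule not_\<rho>)
      ultimately show ?thesis
        unfolding stellar_subdivision_def by (intro UnI2 CollectI exI[of _ F]) simp
    qed
  next
    fix G assume "G \<in> stellar_subdivision (partial_pm S) \<rho> (Inr v0)"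
    then consider "G \<in> partial_pm S" "\<not> \<rho> \<subseteq> G"
      | F where "F \<in> partial_pm S" "\<not> \<rho> \<subseteq> F" "F \<union> \<rho> \<in> partial_pm S" "G = F \<union> {Inr v0}"
      unfolding stellar_subdivision_def by blast
    then show "G \<in> partial_pm (insert v0 S)"
    proof cases
      case 1
      from 1(1) obtain \<sigma> \<tau> \<epsilon> where G: "G = signed_graph \<tau> \<epsilon> <+> signed_face \<sigma> \<epsilon>"
        "\<epsilon> \<in> sign_vectors" "\<sigma> \<in> order_complex (UNIV - {bot})" "\<tau> \<subseteq> {j. join_irreducible j}"
        "signed_face \<sigma> \<epsilon> \<subseteq> S" "\<forall>y\<in>\<sigma>. Sup \<tau> \<le> y" "signed_vertex (Sup \<tau>) \<epsilon> \<notin> S"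
        by (rule partial_pmE)
      then have "signed_vertex (Sup \<tau>) \<epsilon> \<noteq> v0" using \<rho>_iff[OF G(4,2,7)] 1(2) by blast
      then show ?thesis unfolding G(1) using G by (intro partial_pmI) auto
    next
      case (2 F)
      \<comment> \<open>The sign vector representing \<open>F\<close> may disagree with \<delta> on
        the extreme points of \<open>x\<close>. That of \<open>F \<union> \<rho>\<close> cannot, so
        \<open>F\<close> is rewritten with it.\<close>
      obtain \<sigma>1 \<tau> \<epsilon>1 where F: "F = signed_graph \<tau> \<epsilon>1 <+> signed_face \<sigma>1 \<epsilon>1"
        "\<epsilon>1 \<in> sign_vectors" "\<tau> \<subseteq> {j. join_irreducible j}" "signed_vertex (Sup \<tau>) \<epsilon>1 \<notin> S"
        using 2(1) by (rule partial_pmE)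
      obtain \<sigma> \<tau>' \<epsilon> where F': "F \<union> \<rho> = signed_graph \<tau>' \<epsilon> <+> signed_face \<sigma> \<epsilon>"
        "\<epsilon> \<in> sign_vectors" "\<sigma> \<in> order_complex (UNIV - {bot})" "\<tau>' \<subseteq> {j. join_irreducible j}"
        "signed_face \<sigma> \<epsilon> \<subseteq> S" "\<forall>y\<in>\<sigma>. Sup \<tau>' \<le> y" "signed_vertex (Sup \<tau>') \<epsilon> \<notin> S"
        using 2(3) by (rule partial_pmE)
      have "\<rho> \<subseteq> signed_graph \<tau>' \<epsilon> <+> signed_face \<sigma> \<epsilon>" using F'(1) by blast
      then have v': "signed_vertex (Sup \<tau>') \<epsilon> = v0" using \<rho>_iff[OF F'(4,2,7)] by blast
      then have top: "Sup \<tau>' = x" and v0_eq: "signed_vertex x \<epsilon> = v0" using eq_v0[OF F'(2)] by auto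
      have "signed_graph \<tau> \<epsilon>1 \<union> signed_graph (lattice_ext x) \<delta> = signed_graph \<tau>' \<epsilon>"
        and face: "signed_face \<sigma>1 \<epsilon>1 = signed_face \<sigma> \<epsilon>"
        using F'(1) unfolding F(1) \<rho>_def Un_Plus Plus_eq_iff by auto
      then have \<tau>: "\<tau> \<subseteq> \<tau>'" "\<forall>i\<in>\<tau>. \<epsilon>1 i = \<epsilon> i" by auto
      then have "signed_graph \<tau> \<epsilon>1 = signed_graph \<tau> \<epsilon>" by (intro image_cong) auto
      then have F_eq: "F = signed_graph \<tau> \<epsilon> <+> signed_face \<sigma> \<epsilon>" unfolding F(1) face by simp
      have sv: "signed_vertex (Sup \<tau>) \<epsilon> \<notin> S"
        using signed_vertex_Sup_cong[OF F(3,2) F'(2) \<tau>(2)] F(4) by simp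
      have "signed_vertex (Sup \<tau>) \<epsilon> \<noteq> v0" using \<rho>_iff[OF F(3) F'(2) sv] 2(2) F_eq by blast
      moreover have "Sup \<tau> \<le> x" using Sup_subset_mono[OF \<tau>(1)] top by simp
      moreover have "signed_face (insert x \<sigma>) \<epsilon> = insert v0 (signed_face \<sigma> \<epsilon>)"
        using v0_eq by (simp add: signed_face_def)
      moreover have "insert x \<sigma> \<in> order_complex (UNIV - {bot})"
        using F'(3,6) x top by (intro order_complex_insert) auto
      ultimately have "signed_graph \<tau> \<epsilon> <+> signed_face (insert x \<sigma>) \<epsilon> \<in> partial_pm (insert v0 S)"
        using F F' sv top by (intro partial_pmI) (auto intro: order_trans)
      moreover have "G = signed_graph \<tau> \<epsilon> <+> signed_face (insert x \<sigma>) \<epsilon>"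
        unfolding 2(4) F_eq using v0_eq by (auto simp: signed_face_def)
      ultimately show ?thesis by simp
    qed
  qed
  then show ?thesis
    unfolding stellar_step_def v0_def[symmetric] using \<rho>_face \<rho>_ne v_new by blast
qed

text \<open>Upward closure is required across all signs: a vertex may be added at \<open>x\<close>
  only when every class above \<open>x\<close> is present. Choosing \<open>x\<close> maximal among
  the elements with a missing class preserves this, in whatever order the signs of one
  \<open>x\<close> are taken.\<close>

lemma partial_pm_stellar_steps:
  fixes S :: "('a \<times> ('a \<Rightarrow> int)) set set"
  assumes "S \<subseteq> signed_vertices"
    and "\<And>x y \<epsilon> \<delta>. x < y \<Longrightarrow> \<epsilon> \<in> sign_vectors \<Longrightarrow> \<delta> \<in> sign_vectors \<Longrightarrow>
      signed_vertex x \<epsilon> \<in> S \<Longrightarrow> signed_vertex y \<delta> \<in> S"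
  shows "stellar_step\<^sup>*\<^sup>* (partial_pm S) (partial_pm signed_vertices)"
  using assms
proof (induction "card (signed_vertices - S)" arbitrary: S rule: less_induct)
  case less
  show ?case
  proof (cases "S = signed_vertices")
    case False
    define X where "X = {x. x \<noteq> bot \<and> (\<exists>\<epsilon>\<in>sign_vectors. signed_vertex x \<epsilon> \<notin> S)}"
    have "X \<noteq> {}" using False less.prems(1) by (auto simp: X_def signed_vertices_def)
    then obtain x where "x \<in> X" and max: "\<forall>y\<in>X. x \<le> y \<longrightarrow> x = y"
      using finite_has_maximal[of X] by auto
    then obtain \<delta> where x: "x \<noteq> bot" and \<delta>: "\<delta> \<in> sign_vectors" and new: "signed_vertex x \<delta> \<notin> S"
      by (auto simp: X_def)
    have above: "signed_vertex y \<epsilon> \<in> S" if "x < y" "\<epsilon> \<in> sign_vectors" for y \<epsilon>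
    proof -
      have "y \<notin> X" "y \<noteq> bot" using max that(1) by auto
      then show ?thesis using that(2) by (auto simp: X_def)
    qed
    \<comment> \<open>Nothing below \<open>x\<close> is in \<open>S\<close>, as upward closure would
      then put the class of \<open>x\<close> and \<delta> into \<open>S\<close>.\<close>
    have step: "stellar_step (partial_pm S) (partial_pm (insert (signed_vertex x \<delta>) S))"
      using x \<delta> new above less.prems(2)[of _ x _ \<delta>] by (intro partial_pm_insert) auto
    have v: "signed_vertex x \<delta> \<in> signed_vertices" using signed_vertex_in_signed_vertices[OF \<delta>] x by simp
    have "stellar_step\<^sup>*\<^sup>* (partial_pm (insert (signed_vertex x \<delta>) S)) (partial_pm signed_vertices)"
    proof (rule less.hyps)
      show "card (signed_vertices - insert (signed_vertex x \<delta>) S) < card (signed_vertices - S)"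
        using v new finite_signed_vertices by (intro psubset_card_mono) auto
      show "insert (signed_vertex x \<delta>) S \<subseteq> signed_vertices" using v less.prems(1) by simp
      fix y z :: 'a and \<epsilon> \<epsilon>' :: "'a \<Rightarrow> int"
      assume yz: "y < z" and \<epsilon>: "\<epsilon> \<in> sign_vectors" "\<epsilon>' \<in> sign_vectors"
        and y: "signed_vertex y \<epsilon> \<in> insert (signed_vertex x \<delta>) S"
      show "signed_vertex z \<epsilon>' \<in> insert (signed_vertex x \<delta>) S"
      proof (cases "signed_vertex y \<epsilon> \<in> S")
        case True
        then show ?thesis using less.prems(2)[OF yz \<epsilon>] by simp
      next
        case False
        then have "y = x" using y signed_vertex_eq_iff[OF x \<epsilon>(1) \<delta>] by auto
        then show ?thesis using above yz \<epsilon> by simp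
      qed
    qed
    with step show ?thesis by (rule converse_rtranclp_into_rtranclp)
  qed simp
qed

end

text \<open>The only class left outside is the empty one of \<open>bot\<close>, so \<tau> must be
  empty and just the signed chains remain.\<close>

lemma partial_pm_full:
  "complex_isomorphic (partial_pm (signed_vertices :: ('a::{finite, complete_lattice} \<times> _) set set))
     (pm_complex TYPE('a))"
proof -
  have "(\<lambda>\<tau>. Inr ` \<tau>) ` pm_complex TYPE('a) = partial_pm signed_vertices"
  proof (intro equalityI subsetI)
    fix F :: "('a \<times> int + ('a \<times> ('a \<Rightarrow> int)) set) set"
    assume "F \<in> (\<lambda>\<tau>. Inr ` \<tau>) ` pm_complex TYPE('a)"
    then obtain \<sigma> :: "'a set" and \<epsilon> where F: "F = signed_graph {} \<epsilon> <+> signed_face \<sigma> \<epsilon>"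
      "\<sigma> \<in> order_complex (UNIV - {bot})" "\<epsilon> \<in> sign_vectors"
      by (auto simp: pm_complex_def Plus_def)
    then show "F \<in> partial_pm signed_vertices"
      unfolding F(1) using signed_vertex_in_signed_vertices[OF F(3)]
      by (intro partial_pmI) (auto simp: signed_face_def order_complex_def)
  next
    fix F :: "('a \<times> int + ('a \<times> ('a \<Rightarrow> int)) set) set"
    assume "F \<in> partial_pm signed_vertices"
    then obtain \<sigma> \<tau> \<epsilon> where F: "F = signed_graph \<tau> \<epsilon> <+> signed_face \<sigma> \<epsilon>"
      "\<epsilon> \<in> sign_vectors" "\<sigma> \<in> order_complex (UNIV - {bot})" "\<tau> \<subseteq> {j. join_irreducible j}"
      "signed_vertex (Sup \<tau>) \<epsilon> \<notin> signed_vertices"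
      by (rule partial_pmE)
    then have "Sup \<tau> = bot" using signed_vertex_in_signed_vertices by blast
    then have "\<tau> = {}" using F(4) by (auto simp: join_irreducible_def)
    then have "F = Inr ` signed_face \<sigma> \<epsilon>" using F(1) by (simp add: Plus_def)
    moreover have "signed_face \<sigma> \<epsilon> \<in> pm_complex TYPE('a)" using F(2,3) by (auto simp: pm_complex_def)
    ultimately show "F \<in> (\<lambda>\<tau>. Inr ` \<tau>) ` pm_complex TYPE('a)" by blast
  qed
  from complex_isomorphic_sym[OF complex_isomorphicI[OF _ this]] show ?thesis by simp
qed

text \<open>Here the chain is forced to be empty, while \<tau> may be any set of
  irreducibles.\<close>

lemma partial_pm_empty:
  "complex_isomorphic (partial_pm ({} :: ('a::complete_lattice \<times> _) set set))
     (cross_complex {j :: 'a. join_irreducible j})"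
proof -
  let ?J = "{j :: 'a. join_irreducible j}"
  have "(\<lambda>\<tau>. Inl ` \<tau>) ` cross_complex ?J = partial_pm {}"
  proof (intro equalityI subsetI)
    fix F :: "('a \<times> int + ('a \<times> ('a \<Rightarrow> int)) set) set"
    assume "F \<in> (\<lambda>\<tau>. Inl ` \<tau>) ` cross_complex ?J"
    then obtain \<tau> \<epsilon> where F: "F = Inl ` signed_graph \<tau> \<epsilon>" "\<tau> \<subseteq> ?J" "\<forall>i\<in>?J. \<epsilon> i \<in> {1, - 1}"
      by (auto simp: cross_complex_def)
    \<comment> \<open>\<open>sign_vectors\<close> consists of extensional functions, so the signs
      are reset outside the irreducibles.\<close>
    have "signed_graph \<tau> \<epsilon> = signed_graph \<tau> (restrict \<epsilon> ?J)" using F(2) by (intro image_cong) auto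
    then have eq: "F = signed_graph \<tau> (restrict \<epsilon> ?J) <+> signed_face {} (restrict \<epsilon> ?J)"
      using F(1) by (simp add: signed_face_def Plus_def)
    have "restrict \<epsilon> ?J \<in> sign_vectors" using F(3) unfolding sign_vectors_def by auto
    then show "F \<in> partial_pm {}" unfolding eq using F(2)
      by (intro partial_pmI) (simp_all add: signed_face_def del: restrict_apply)
  next
    fix F :: "('a \<times> int + ('a \<times> ('a \<Rightarrow> int)) set) set"
    assume "F \<in> partial_pm {}"
    then obtain \<sigma> \<tau> \<epsilon> where F: "F = signed_graph \<tau> \<epsilon> <+> signed_face \<sigma> \<epsilon>"
      "\<epsilon> \<in> sign_vectors" "\<tau> \<subseteq> ?J" "signed_face \<sigma> \<epsilon> \<subseteq> {}"
      by (rule partial_pmE)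
    then have "F = Inl ` signed_graph \<tau> \<epsilon>" by (simp add: Plus_def)
    moreover have "\<forall>i\<in>?J. \<epsilon> i \<in> {1, - 1}" using F(2) by (auto simp: sign_vectors_def)
    then have "signed_graph \<tau> \<epsilon> \<in> cross_complex ?J" unfolding cross_complex_def using F(3) by blast
    ultimately show "F \<in> (\<lambda>\<tau>. Inl ` \<tau>) ` cross_complex ?J" by blast
  qed
  from complex_isomorphic_sym[OF complex_isomorphicI[OF _ this]] show ?thesis by simp
qed

section \<open>Integer and geometric realizations of the same subdivision steps\<close>

theorem theorem3p2:
  fixes L :: "'a::{finite, complete_lattice} itself" and n :: nat
  assumes "meet_distributive L"
    and "CARD('a) > 1"
    and "n = card {j::'a. join_irreducible j}"
  shows "(\<exists>\<Gamma>. stellar_step\<^sup>*\<^sup>* (crosspolytope_boundary n) \<Gamma> \<and>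
            complex_isomorphic \<Gamma> (pm_complex L)) \<and>
         (\<exists>P :: (real, 'a) vec set. simplicial_polytope P \<and> aff_dim P = int n \<and>
            complex_isomorphic (boundary_complex P) (pm_complex L))"
proof -
  let ?J = "{j::'a. join_irreducible j}"
  have L: "pm_complex L = pm_complex TYPE('a)" by (simp add: pm_complex_def)
  have md: "meet_distributive TYPE('a)" using assms(1) by (simp add: meet_distributive_def)
  have "(top :: 'a) \<noteq> bot"
  proof
    assume "(top :: 'a) = bot"
    then have "x = bot" for x :: 'a by (metis bot_unique top_greatest)
    then have "(UNIV :: 'a set) = {bot}" by auto
    then show False using assms(2) by (metis One_nat_def card.empty card.insert empty_iff
          finite.emptyI less_irrefl)
  qed
  then have "\<not> (top :: 'a) \<le> bot" by (simp add: bot_unique)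
  \<comment> \<open>A join-irreducible exists, so the dimension is positive and the initial fan is
    nontrivial.\<close>
  then have J: "?J \<noteq> {}" by (auto elim: join_irreducible_separates)
  have steps: "stellar_step\<^sup>*\<^sup>* (partial_pm {}) (partial_pm (signed_vertices :: ('a \<times> _) set set))"
    by (rule partial_pm_stellar_steps[OF md]) auto
  have full: "complex_isomorphic (partial_pm (signed_vertices :: ('a \<times> _) set set)) (pm_complex L)"
    unfolding L by (rule partial_pm_full)
  have start: "complex_isomorphic (partial_pm ({} :: ('a \<times> _) set set)) (crosspolytope_boundary n)"
    unfolding assms(3)
    by (rule complex_isomorphic_trans[OF partial_pm_empty cross_complex_isomorphic_crosspolytope]) simp
  have "\<Union>(crosspolytope_boundary n) \<subseteq> {i. \<bar>i\<bar> \<le> int n}"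
    by (auto simp: crosspolytope_boundary_def)
  also have "\<dots> \<subseteq> {- int n..int n}" by auto
  finally have fin: "finite (\<Union>(crosspolytope_boundary n))" by (rule finite_subset) simp
  \<comment> \<open>Any fresh integer can be the new vertex, so finiteness is the only invariant to
    carry.\<close>
  have "\<exists>v. v \<notin> \<Union>G \<and> finite (\<Union>(stellar_subdivision G \<sigma> v))"
    if "finite (\<Union>G)" for G :: "int set set" and \<sigma>
  proof -
    obtain v where "v \<notin> \<Union>G" using ex_new_if_finite[OF infinite_UNIV_int \<open>finite (\<Union>G)\<close>] by blast
    moreover have "\<Union>(stellar_subdivision G \<sigma> v) \<subseteq> insert v (\<Union>G)"
      by (auto simp: stellar_subdivision_def)
    ultimately show ?thesis using that by (meson finite.insertI finite_subset)
  qed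
  then obtain \<Gamma> where \<Gamma>: "stellar_step\<^sup>*\<^sup>* (crosspolytope_boundary n) \<Gamma>"
    "complex_isomorphic (partial_pm (signed_vertices :: ('a \<times> _) set set)) \<Gamma>"
    using stellar_steps_transport[OF steps start, of "\<lambda>G. finite (\<Union>G)"] fin by blast
  have "complex_isomorphic \<Gamma> (pm_complex L)"
    using complex_isomorphic_trans[OF complex_isomorphic_sym[OF \<Gamma>(2)] full] .
  moreover
  obtain G0 and W :: "(real, 'a) vec set" where G0: "polytopal_fan W G0" "dim W = n"
    "complex_isomorphic (cross_complex ?J) G0"
    using cross_complex_polytopal[OF J] assms(3) by blast
  \<comment> \<open>The same steps, now starting from the geometric crosspolytope; each new vertex
    is a displaced barycentre.\<close>
  obtain G where G: "polytopal_fan W G"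
    "complex_isomorphic (partial_pm (signed_vertices :: ('a \<times> _) set set)) G"
    using stellar_steps_transport[OF steps complex_isomorphic_trans[OF partial_pm_empty G0(3)],
        of "polytopal_fan W"] G0(1) polytopal_fan_stellar_subdivision by blast
  have "complex_isomorphic (boundary_complex (convex hull \<Union>G)) (pm_complex L)"
    unfolding boundary_complex_hull[OF G(1)]
    using complex_isomorphic_trans[OF complex_isomorphic_sym[OF G(2)] full] .
  ultimately show ?thesis
    using \<Gamma>(1) simplicial_polytope_hull[OF G(1)] aff_dim_hull[OF G(1)] G0(2) by blast
qed

end
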